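(* There is a total functional $F:2^{\mathbb{N}}\to\mathbb{N}$ computable in $\exists^2$ such that the set of neighbourhoods $C_{\overline{f}F(f)}$, where $f$ varies over all binary hyperarithmetical functions, is not a cover of $2^{\mathbb{N}}$.
   Context: The metatheory is $\textsf{ZFC}$. "Computable" (in given functionals) means Kleene computable via the schemes S1–S9. For $f\in2^{\mathbb{N}}$, $\overline{f}N=\langle f(0),\dots,f(N-1)\rangle$, and for a finite binary sequence $\sigma$, $C_\sigma$ is the set of all $g\in2^{\mathbb{N}}$ extending $\sigma$. $\exists^2:\mathbb{N}^{\mathbb{N}}\to\{0,1\}$ is the functional with $\exists^2(f)=0$ if and only if $(\exists n)(f(n)=0)$. A function $f:\mathbb{N}\to\mathbb{N}$ is hyperarithmetical if its graph is (lightface) $\Delta^1_1$, equivalently if $f$ is computable in $\exists^2$. *)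

theory Defs
  imports "HOL-Library.Nat_Bijection"
begin

text \<open>
  Arguments are objects of pure type 0, 1 and 2 over the full type structure. Starting from
  arguments of type at most 2, the schemes only ever call subcomputations on arguments of type at
  most 2 (the bound variable of S8 then has type 0), so this fragment agrees with
  Kleene's definition over all finite types.
\<close>

datatype arg = T0 nat | T1 "nat \<Rightarrow> nat" | T2 "(nat \<Rightarrow> nat) \<Rightarrow> nat"

text \<open>
  \<open>kleene e \<Phi> a\<close> is \<open>{e}(\<Phi>) = a\<close>. Indices are numbers because S9 takes one as an argument;
  the coding \<^const>\<open>list_encode\<close> is an explicit primitive recursive bijection.
  S8 requires \<open>\<lambda>x. {d}(x, H, \<Phi>)\<close> to be total. Single-valuedness is \<open>kleene_unique\<close>.
\<close>

inductive kleene :: "nat \<Rightarrow> arg list \<Rightarrow> nat \<Rightarrow> bool" where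
  S1: "kleene (list_encode [1]) (T0 x # \<Phi>) (Suc x)"
| S2: "kleene (list_encode [2, q]) \<Phi> q"
| S3: "kleene (list_encode [3]) (T0 x # \<Phi>) x"
| S4: "kleene d' \<Phi> b \<Longrightarrow> kleene d (T0 b # \<Phi>) a
        \<Longrightarrow> kleene (list_encode [4, d, d']) \<Phi> a"
| S5_0: "kleene d \<Phi> a \<Longrightarrow> kleene (list_encode [5, d, d']) (T0 0 # \<Phi>) a"
| S5_Suc: "kleene (list_encode [5, d, d']) (T0 x # \<Phi>) b
        \<Longrightarrow> kleene d' (T0 x # T0 b # \<Phi>) a
        \<Longrightarrow> kleene (list_encode [5, d, d']) (T0 (Suc x) # \<Phi>) a"
| S6: "distinct \<pi> \<Longrightarrow> set \<pi> = {..<length \<Phi>} \<Longrightarrow> kleene d (map (\<lambda>i. \<Phi> ! i) \<pi>) a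
        \<Longrightarrow> kleene (list_encode [6, d, list_encode \<pi>]) \<Phi> a"
| S7: "kleene (list_encode [7]) (T1 f # T0 x # \<Phi>) (f x)"
| S8: "(\<And>x. kleene d (T0 x # T2 H # \<Phi>) (g x))
        \<Longrightarrow> kleene (list_encode [8, d]) (T2 H # \<Phi>) (H g)"
| S9: "kleene d \<Phi> a
        \<Longrightarrow> kleene (list_encode [9, length \<Phi>]) (T0 d # \<Phi> @ \<Psi>) a"

lemma kleene_unique: "kleene e \<Phi> a \<Longrightarrow> kleene e \<Phi> b \<Longrightarrow> a = b"
proof (induction arbitrary: b rule: kleene.induct)
  case (S4 d' \<Phi> c d a)
  from S4.prems show ?case
    by (cases rule: kleene.cases) (use S4.IH in \<open>auto simp: list_encode_eq simp del: list_encode.simps\<close>)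
next
  case (S5_0 d \<Phi> a d')
  from S5_0.prems show ?case
    by (cases rule: kleene.cases) (use S5_0.IH in \<open>auto simp: list_encode_eq simp del: list_encode.simps\<close>)
next
  case (S5_Suc d d' x \<Phi> c a)
  from S5_Suc.prems show ?case
    by (cases rule: kleene.cases) (use S5_Suc.IH in \<open>auto simp: list_encode_eq simp del: list_encode.simps\<close>)
next
  case (S6 \<pi> \<Phi> d a)
  from S6.prems show ?case
    by (cases rule: kleene.cases) (use S6.IH in \<open>auto simp: list_encode_eq simp del: list_encode.simps\<close>)
next
  case (S8 d H \<Phi> g)
  from S8.prems obtain g' where "b = H g'" and "\<And>x. kleene d (T0 x # T2 H # \<Phi>) (g' x)"
    by (cases rule: kleene.cases) (auto simp: list_encode_eq simp del: list_encode.simps)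
  with S8.IH have "g = g'" by blast
  with \<open>b = H g'\<close> show ?case by simp
next
  case (S9 d \<Phi> a \<Psi>)
  from S9.prems show ?case
    by (cases rule: kleene.cases) (use S9.IH in \<open>auto simp: list_encode_eq simp del: list_encode.simps\<close>)
qed (erule kleene.cases; auto simp: list_encode_eq simp del: list_encode.simps)+

definition E2 :: "(nat \<Rightarrow> nat) \<Rightarrow> nat" where
  "E2 f = (if \<exists>n. f n = 0 then 0 else 1)"

definition cantor :: "(nat \<Rightarrow> nat) set" where
  "cantor = {f. \<forall>n. f n \<in> {0, 1}}"

definition nbhd :: "nat list \<Rightarrow> (nat \<Rightarrow> nat) set" where
  "nbhd \<sigma> = {g \<in> cantor. map g [0..<length \<sigma>] = \<sigma>}"

text \<open>
  A functional on Cantor space is represented by a function on \<^typ>\<open>nat \<Rightarrow> nat\<close> of which only the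
  values on \<^const>\<open>cantor\<close> matter; the index need not give a value elsewhere.
\<close>

definition computable_on_cantor_in ::
    "((nat \<Rightarrow> nat) \<Rightarrow> nat) \<Rightarrow> ((nat \<Rightarrow> nat) \<Rightarrow> nat) \<Rightarrow> bool" where
  "computable_on_cantor_in H F \<longleftrightarrow> (\<exists>e. \<forall>f\<in>cantor. kleene e [T1 f, T2 H] (F f))"

text \<open>
  Arithmetical formulas with number variables \<open>Var i\<close> and one free function variable, applied to
  a term by \<open>App\<close>. No other function or set parameters occur, so the classes below are lightface.
\<close>

datatype tm = Var nat | Zero | Succ tm | Add tm tm | Mult tm tm | App tm

datatype arith_fm = Eq tm tm | Less tm tm | Neg arith_fm | Conj arith_fm arith_fm
  | Ex nat arith_fm

primrec tm_val :: "(nat \<Rightarrow> nat) \<Rightarrow> (nat \<Rightarrow> nat) \<Rightarrow> tm \<Rightarrow> nat" where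
  "tm_val g v (Var i) = v i"
| "tm_val g v Zero = 0"
| "tm_val g v (Succ t) = Suc (tm_val g v t)"
| "tm_val g v (Add s t) = tm_val g v s + tm_val g v t"
| "tm_val g v (Mult s t) = tm_val g v s * tm_val g v t"
| "tm_val g v (App t) = g (tm_val g v t)"

primrec sat :: "(nat \<Rightarrow> nat) \<Rightarrow> (nat \<Rightarrow> nat) \<Rightarrow> arith_fm \<Rightarrow> bool" where
  "sat g v (Eq s t) \<longleftrightarrow> tm_val g v s = tm_val g v t"
| "sat g v (Less s t) \<longleftrightarrow> tm_val g v s < tm_val g v t"
| "sat g v (Neg \<phi>) \<longleftrightarrow> \<not> sat g v \<phi>"
| "sat g v (Conj \<phi> \<psi>) \<longleftrightarrow> sat g v \<phi> \<and> sat g v \<psi>"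
| "sat g v (Ex i \<phi>) \<longleftrightarrow> (\<exists>x. sat g (v(i := x)) \<phi>)"

text \<open>Number variables other than the two inputs 0 and 1 are initially 0.\<close>

definition inputs :: "nat \<times> nat \<Rightarrow> nat \<Rightarrow> nat" where
  "inputs p = (\<lambda>_. 0)(0 := fst p, 1 := snd p)"

definition sigma11 :: "(nat \<times> nat) set \<Rightarrow> bool" where
  "sigma11 A \<longleftrightarrow> (\<exists>\<phi>. A = {p. \<exists>g. sat g (inputs p) \<phi>})"

definition pi11 :: "(nat \<times> nat) set \<Rightarrow> bool" where
  "pi11 A \<longleftrightarrow> (\<exists>\<phi>. A = {p. \<forall>g. sat g (inputs p) \<phi>})"

definition delta11 :: "(nat \<times> nat) set \<Rightarrow> bool" where
  "delta11 A \<longleftrightarrow> sigma11 A \<and> pi11 A"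

definition hyperarithmetical :: "(nat \<Rightarrow> nat) \<Rightarrow> bool" where
  "hyperarithmetical f \<longleftrightarrow> delta11 {(n, m). f n = m}"

end

theory Submission
  imports Defs
begin

text \<open>
  The functional \<open>F\<close> checks its argument \<open>f\<close> against the recursion equations of a function on a
  pseudo-well-founded set and returns \<open>x + 1\<close> for a place \<open>x\<close> where \<open>f\<close> violates its
  equation although no place below \<open>x\<close> does.

  The order used is ill-founded, but every nonempty hyperarithmetical set has a minimal element.
  Hence two hyperarithmetical functions that are correct below \<open>x\<close> agree there, so both are forced
  to the same wrong value at \<open>x\<close>: for binary \<open>f\<close>, the value \<open>f x\<close> depends on \<open>x\<close> only. A function \<open>X\<close>
  that takes the other value at every such \<open>x\<close> then differs from \<open>f\<close> before \<open>F f\<close>.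

  It remains to find a recursion without hyperarithmetical solution, so that every
  hyperarithmetical \<open>f\<close> has a violation. It evaluates, for each \<open>e\<close>, a game between two players
  who build witnesses of \<open>{e}(e) = 1\<close> and \<open>{e}(e) = 0\<close>, where \<open>{e}\<close> is the \<open>e\<close>-th
  \<open>\<Sigma>\<^sup>1\<^sub>1\<close> relation, written like a function. If exactly one of the two has a witness, any
  solution names that player as the winner, so a hyperarithmetical solution would
  allow diagonalizing against all hyperarithmetical functions. The second player also has to build a
  solution of the same recursion for the game without this extra task; such solutions exist by
  Knaster-Tarski, and none is hyperarithmetical, which makes the order well-founded for
  hyperarithmetical sets.
\<close>

section \<open>Arithmetical operators\<close>

definition pr :: "nat \<Rightarrow> nat \<Rightarrow> nat" where "pr a b = prod_encode (a, b)"
definition pfst :: "nat \<Rightarrow> nat" where "pfst x = fst (prod_decode x)"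
definition psnd :: "nat \<Rightarrow> nat" where "psnd x = snd (prod_decode x)"

lemma pfst_pr [simp]: "pfst (pr a b) = a"
  and psnd_pr [simp]: "psnd (pr a b) = b"
  and pr_eta [simp]: "pr (pfst x) (psnd x) = x"
  by (simp_all add: pr_def pfst_def psnd_def)

lemma pfst_le: "pfst x \<le> x" and psnd_le: "psnd x \<le> x"
  by (metis le_prod_encode_1 pr_def pr_eta) (metis le_prod_encode_2 pr_def pr_eta)

lemma pfst_0 [simp]: "pfst 0 = 0"
  using pfst_le[of 0] by simp

text \<open>Failure is coded by 0 and success is shifted by one. This makes search total, and
  \<open>AOP_ex\<close> obtains number quantifiers from it.\<close>

definition mu :: "(nat \<Rightarrow> nat) \<Rightarrow> nat" where
  "mu h = (if \<exists>y. h y \<noteq> 0 then Suc (LEAST y. h y \<noteq> 0) else 0)"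

lemma mu_eq_0_iff: "mu h = 0 \<longleftrightarrow> (\<forall>y. h y = 0)"
  by (simp add: mu_def)

lemma mu_eq_Suc_iff: "mu h = Suc n \<longleftrightarrow> h n \<noteq> 0 \<and> (\<forall>y<n. h y = 0)"
proof
  assume "mu h = Suc n"
  then have ex: "\<exists>y. h y \<noteq> 0" and n: "n = (LEAST y. h y \<noteq> 0)"
    by (auto simp: mu_def split: if_splits)
  show "h n \<noteq> 0 \<and> (\<forall>y<n. h y = 0)"
    unfolding n using LeastI_ex[OF ex] not_less_Least[of _ "\<lambda>y. h y \<noteq> 0"] by blast
next
  assume n: "h n \<noteq> 0 \<and> (\<forall>y<n. h y = 0)"
  then have "(LEAST y. h y \<noteq> 0) = n"
    by (intro Least_equality) (auto simp: not_less[symmetric])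
  with n show "mu h = Suc n"
    by (auto simp: mu_def)
qed

text \<open>Code 0 is reserved for the argument function. Any other \<open>t\<close> is one plus a
  nested pair, which makes both subcodes smaller than \<open>t\<close>.\<close>

definition opc :: "nat \<Rightarrow> nat" where "opc t = pfst (t - 1)"
definition lft :: "nat \<Rightarrow> nat" where "lft t = pfst (psnd (t - 1))"
definition rgt :: "nat \<Rightarrow> nat" where "rgt t = psnd (psnd (t - 1))"
definition mk :: "nat \<Rightarrow> nat \<Rightarrow> nat \<Rightarrow> nat" where "mk k b c = Suc (pr k (pr b c))"

lemma mk_sel [simp]: "opc (mk k b c) = k" "lft (mk k b c) = b" "rgt (mk k b c) = c" "mk k b c \<noteq> 0"
  by (simp_all add: opc_def lft_def rgt_def mk_def)

lemma lft_less: "t \<noteq> 0 \<Longrightarrow> lft t < t" and rgt_less: "t \<noteq> 0 \<Longrightarrow> rgt t < t"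
proof -
  assume "t \<noteq> 0"
  moreover have "lft t \<le> t - 1" "rgt t \<le> t - 1"
    unfolding lft_def rgt_def using pfst_le psnd_le order_trans by blast+
  ultimately show "lft t < t" "rgt t < t" by auto
qed

text \<open>
  Every number is read as the code of an operator. The clauses for \<open>pr\<close>, composition, iteration and
  \<open>mu\<close> are chosen such that an evaluation table can be checked locally, with three look-ups per entry.
\<close>

function ev :: "(nat \<Rightarrow> nat) \<Rightarrow> nat \<Rightarrow> nat \<Rightarrow> nat" where
  "ev f t =
    (if t = 0 then f
     else if opc t = 0 then Suc
     else if opc t = 1 then pfst
     else if opc t = 2 then psnd
     else if opc t = 3 then (\<lambda>x. pr (ev f (lft t) x) (ev f (rgt t) x))
     else if opc t = 4 then (\<lambda>x. ev f (lft t) (ev f (rgt t) x))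
     else if opc t = 5 then (\<lambda>x. (ev f (lft t) ^^ pfst x) (psnd x))
     else (\<lambda>x. mu (\<lambda>y. ev f (lft t) (pr y x))))"
  by pat_completeness auto
termination
  by (relation "measure snd") (auto simp: lft_less rgt_less)

declare ev.simps [simp del]

lemma ev_0 [simp]: "ev f 0 = f"
  by (simp add: ev.simps)

lemma ev_mk:
  "ev f (mk 0 b c) = Suc"
  "ev f (mk (Suc 0) b c) = pfst"
  "ev f (mk 2 b c) = psnd"
  "ev f (mk 3 b c) = (\<lambda>x. pr (ev f b x) (ev f c x))"
  "ev f (mk 4 b c) = (\<lambda>x. ev f b (ev f c x))"
  "ev f (mk 5 b c) = (\<lambda>x. (ev f b ^^ pfst x) (psnd x))"
  "ev f (mk 6 b c) = (\<lambda>x. mu (\<lambda>y. ev f b (pr y x)))"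
  by (subst ev.simps, simp)+

text \<open>
  Up to coding, these are the operators arithmetical in their function argument. The codes are
  uniform in that argument.
\<close>

definition AO :: "((nat \<Rightarrow> nat) \<Rightarrow> nat \<Rightarrow> nat) \<Rightarrow> bool" where
  "AO \<Psi> \<longleftrightarrow> (\<exists>t. \<forall>f. ev f t = \<Psi> f)"

lemma AO_I: "(\<And>f. ev f t = \<Psi> f) \<Longrightarrow> AO \<Psi>"
  by (auto simp: AO_def)

lemma AO_induct [consumes 1, case_names arg Suc fst snd pair comp iter mu]:
  assumes "AO \<Psi>"
    and arg: "P (\<lambda>f. f)"
    and Suc: "P (\<lambda>f. Suc)"
    and fst: "P (\<lambda>f. pfst)"
    and snd: "P (\<lambda>f. psnd)"
    and pair: "\<And>A B. P A \<Longrightarrow> P B \<Longrightarrow> P (\<lambda>f x. pr (A f x) (B f x))"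
    and comp: "\<And>A B. P A \<Longrightarrow> P B \<Longrightarrow> P (\<lambda>f x. A f (B f x))"
    and iter: "\<And>A. P A \<Longrightarrow> P (\<lambda>f x. (A f ^^ pfst x) (psnd x))"
    and mu: "\<And>A. P A \<Longrightarrow> P (\<lambda>f x. mu (\<lambda>y. A f (pr y x)))"
  shows "P \<Psi>"
proof -
  have "P (\<lambda>f. ev f t)" for t
  proof (induction t rule: less_induct)
    case (less t)
    show ?case
    proof (cases "t = 0")
      case True
      then show ?thesis by (simp add: arg)
    next
      case False
      then have l: "P (\<lambda>f. ev f (lft t))" and r: "P (\<lambda>f. ev f (rgt t))"
        using less lft_less rgt_less by blast+
      show ?thesis
        unfolding ev.simps[of _ t]
        using False Suc fst snd pair[OF l r] comp[OF l r] iter[OF l] mu[OF l]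
        by (cases "opc t = 0"; cases "opc t = 1"; cases "opc t = 2"; cases "opc t = 3";
            cases "opc t = 4"; cases "opc t = 5"; simp)
    qed
  qed
  moreover obtain t where "(\<lambda>f. ev f t) = \<Psi>"
    using \<open>AO \<Psi>\<close> by (auto simp: AO_def)
  ultimately show ?thesis by blast
qed

section \<open>Closure properties of arithmetical operators\<close>

lemma AO_oracle0: "AO (\<lambda>f. f)"
  by (rule AO_I[of 0]) simp

lemma AO_comp:
  assumes "AO A" "AO B"
  shows "AO (\<lambda>f x. A f (B f x))"
proof -
  obtain a b where "\<forall>f. ev f a = A f" "\<forall>f. ev f b = B f"
    using assms by (auto simp: AO_def)
  then show ?thesis by (intro AO_I[of "mk 4 a b"]) (simp add: ev_mk)
qed

lemma AO_oracle: "AO A \<Longrightarrow> AO (\<lambda>f x. f (A f x))"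
  by (rule AO_comp[OF AO_oracle0])

lemma AO_Suc: "AO A \<Longrightarrow> AO (\<lambda>f x. Suc (A f x))"
  by (rule AO_comp[of "\<lambda>_. Suc", OF AO_I[of "mk 0 0 0"]]) (simp_all add: ev_mk)

lemma AO_pfst: "AO A \<Longrightarrow> AO (\<lambda>f x. pfst (A f x))"
  by (rule AO_comp[of "\<lambda>_. pfst", OF AO_I[of "mk 1 0 0"]]) (simp_all add: ev_mk)

lemma AO_psnd: "AO A \<Longrightarrow> AO (\<lambda>f x. psnd (A f x))"
  by (rule AO_comp[of "\<lambda>_. psnd", OF AO_I[of "mk 2 0 0"]]) (simp_all add: ev_mk)

lemma AO_pr:
  assumes "AO A" "AO B"
  shows "AO (\<lambda>f x. pr (A f x) (B f x))"
proof -
  obtain a b where "\<forall>f. ev f a = A f" "\<forall>f. ev f b = B f"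
    using assms by (auto simp: AO_def)
  then show ?thesis by (intro AO_I[of "mk 3 a b"]) (simp add: ev_mk)
qed

lemma AO_id: "AO (\<lambda>f x. x)"
proof -
  have "AO (\<lambda>f x. pr (pfst x) (psnd x))"
    by (intro AO_I[of "mk 3 (mk 1 0 0) (mk 2 0 0)"]) (simp add: ev_mk)
  then show ?thesis by simp
qed

lemma AO_mu:
  assumes "AO (\<lambda>f z. h f (psnd z) (pfst z))"
  shows "AO (\<lambda>f x. mu (h f x))"
proof -
  obtain a where "\<forall>f. ev f a = (\<lambda>z. h f (psnd z) (pfst z))"
    using assms by (auto simp: AO_def)
  then show ?thesis by (intro AO_I[of "mk 6 a 0"]) (simp add: ev_mk)
qed

lemma AO_const: "AO (\<lambda>f x. c)"
proof (induction c)
  case 0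
  \<comment> \<open>No constant is among the basic operators. Since \<open>Suc 0\<close> is nonzero,
    the search stops at once with value 1, whose first component is 0.\<close>
  have "AO (\<lambda>f x. pfst (mu (\<lambda>y. Suc y)))"
    by (intro AO_pfst AO_mu AO_Suc AO_id)
  moreover have "mu Suc = 1"
    by (simp add: mu_eq_Suc_iff)
  moreover have "pfst 1 = 0"
    by (simp add: pfst_def prod_decode_def prod_decode_aux.simps)
  ultimately show ?case by simp
qed (rule AO_Suc)

text \<open>The iteration clause admits no parameter, so \<open>x\<close> is carried along as the
  second component of the iterated state.\<close>

lemma AO_iter:
  assumes "AO (\<lambda>f z. h f (psnd z) (pfst z))" "AO N" "AO A"
  shows "AO (\<lambda>f x. (h f x ^^ N f x) (A f x))"
proof -
  have "AO (\<lambda>f z. pr (h f (psnd z) (pfst z)) (psnd z))"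
    by (intro AO_pr AO_psnd AO_id assms)
  then obtain a where a: "\<forall>f. ev f a = (\<lambda>z. pr (h f (psnd z) (pfst z)) (psnd z))"
    by (auto simp: AO_def)
  have it: "(ev f a ^^ n) (pr u x) = pr ((h f x ^^ n) u) x" for f n u x
    by (induction n) (simp_all add: a)
  have it5: "AO (\<lambda>f. ev f (mk 5 a 0))"
    by (rule AO_I) simp
  have "AO (\<lambda>f x. pfst (ev f (mk 5 a 0) (pr (N f x) (pr (A f x) x))))"
    by (intro AO_pfst AO_comp[OF it5] AO_pr AO_id assms)
  then show ?thesis by (simp add: ev_mk it)
qed

lemma AO_subst:
  assumes "AO A" "AO B"
  shows "AO (\<lambda>f. A (B f))"
  using assms(1)
proof (induction rule: AO_induct)
  case arg
  show ?case using assms(2) .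
next
  case (pair A B)
  then show ?case by (rule AO_pr)
next
  case (comp A B)
  then show ?case by (rule AO_comp)
next
  case (iter A)
  show ?case
    by (intro AO_iter AO_comp[OF iter] AO_pfst AO_psnd AO_id)
next
  case (mu A)
  show ?case
    by (intro AO_mu AO_comp[OF mu] AO_pr AO_pfst AO_psnd AO_id)
qed (intro AO_Suc AO_pfst AO_psnd AO_id)+

lemma AO_case_0:
  assumes "AO N" "AO A" "AO B"
  shows "AO (\<lambda>f x. if N f x = 0 then A f x else B f x)"
proof -
  have "AO (\<lambda>f x. ((\<lambda>_. B f x) ^^ N f x) (A f x))"
    by (intro AO_iter AO_comp[OF assms(3)] assms AO_psnd AO_id)
  moreover have "((\<lambda>_. b) ^^ n) a = (if n = 0 then a else b)" for a b n :: nat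
    by (cases n) auto
  ultimately show ?thesis by simp
qed

lemma AO_add: "AO A \<Longrightarrow> AO B \<Longrightarrow> AO (\<lambda>f x. A f x + B f x)"
proof -
  assume "AO A" "AO B"
  then have "AO (\<lambda>f x. (Suc ^^ B f x) (A f x))"
    by (intro AO_iter AO_Suc AO_pfst AO_id)
  moreover have "(Suc ^^ b) a = a + b" for a b
    by (induction b) auto
  ultimately show ?thesis by (simp add: add.commute)
qed

lemma AO_mult: "AO A \<Longrightarrow> AO B \<Longrightarrow> AO (\<lambda>f x. A f x * B f x)"
proof -
  assume A: "AO A" and B: "AO B"
  have "AO (\<lambda>f x. ((\<lambda>u. u + A f x) ^^ B f x) 0)"
    by (intro AO_iter AO_add AO_pfst AO_psnd AO_id AO_const AO_comp[OF A] B)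
  moreover have "((\<lambda>u. u + a) ^^ b) 0 = a * b" for a b :: nat
    by (induction b) auto
  ultimately show ?thesis by simp
qed

lemma AO_pred: "AO A \<Longrightarrow> AO (\<lambda>f x. A f x - 1)"
proof -
  assume "AO A"
  then have "AO (\<lambda>f x. psnd (((\<lambda>u. pr (Suc (pfst u)) (pfst u)) ^^ A f x) (pr 0 0)))"
    by (intro AO_iter AO_Suc AO_pr AO_pfst AO_psnd AO_id AO_const)
  moreover have "((\<lambda>u. pr (Suc (pfst u)) (pfst u)) ^^ n) (pr 0 0) = pr n (n - 1)" for n
    by (induction n) auto
  ultimately show ?thesis by simp
qed

lemma AO_diff: "AO A \<Longrightarrow> AO B \<Longrightarrow> AO (\<lambda>f x. A f x - B f x)"
proof -
  assume A: "AO A" and B: "AO B"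
  have "AO (\<lambda>f x. ((\<lambda>u. u - 1) ^^ B f x) (A f x))"
    by (intro AO_iter AO_pred AO_pfst AO_id A B)
  moreover have "((\<lambda>u. u - 1) ^^ b) a = a - b" for a b :: nat
    by (induction b) auto
  ultimately show ?thesis by simp
qed

section \<open>Arithmetical predicates\<close>

definition AOP :: "((nat \<Rightarrow> nat) \<Rightarrow> nat \<Rightarrow> bool) \<Rightarrow> bool" where
  "AOP P \<longleftrightarrow> AO (\<lambda>f x. of_bool (P f x))"

lemma AOP_zero: "AO A \<Longrightarrow> AOP (\<lambda>f x. A f x = 0)"
  unfolding AOP_def of_bool_def by (intro AO_case_0 AO_const)

lemma AOP_not:
  assumes "AOP P"
  shows "AOP (\<lambda>f x. \<not> P f x)"
proof -
  have "AOP (\<lambda>f x. of_bool (P f x) = (0 :: nat))"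
    using assms unfolding AOP_def[of P] by (rule AOP_zero)
  then show ?thesis by (simp only: of_bool_eq_0_iff)
qed

lemma AOP_conj:
  assumes "AOP P" "AOP Q"
  shows "AOP (\<lambda>f x. P f x \<and> Q f x)"
  using AO_mult[OF assms[unfolded AOP_def]] by (simp only: AOP_def of_bool_conj)

lemma AOP_disj:
  assumes "AOP P" "AOP Q"
  shows "AOP (\<lambda>f x. P f x \<or> Q f x)"
  using AOP_not[OF AOP_conj[OF assms[THEN AOP_not]]] by (simp only: de_Morgan_conj not_not)

lemma AOP_imp:
  assumes "AOP P" "AOP Q"
  shows "AOP (\<lambda>f x. P f x \<longrightarrow> Q f x)"
  using AOP_disj[OF assms(1)[THEN AOP_not] assms(2)] by (simp only: imp_conv_disj)

lemma AOP_iff: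
  assumes "AOP P" "AOP Q"
  shows "AOP (\<lambda>f x. P f x \<longleftrightarrow> Q f x)"
  using AOP_conj[OF AOP_imp[OF assms] AOP_imp[OF assms(2,1)]] by (simp only: iff_conv_conj_imp)

lemma AOP_less: "AO A \<Longrightarrow> AO B \<Longrightarrow> AOP (\<lambda>f x. A f x < B f x)"
proof -
  assume "AO A" "AO B"
  then have "AOP (\<lambda>f x. \<not> (B f x - A f x = 0))"
    by (intro AOP_not AOP_zero AO_diff)
  then show ?thesis by (simp add: not_le)
qed

lemma AOP_eq: "AO A \<Longrightarrow> AO B \<Longrightarrow> AOP (\<lambda>f x. A f x = B f x)"
proof -
  assume "AO A" "AO B"
  then have "AOP (\<lambda>f x. \<not> A f x < B f x \<and> \<not> B f x < A f x)"
    by (intro AOP_conj AOP_not AOP_less)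
  moreover have "(\<not> a < b \<and> \<not> b < a) \<longleftrightarrow> a = b" for a b :: nat by auto
  ultimately show ?thesis by simp
qed

lemma AOP_ex:
  assumes "AOP (\<lambda>f z. P f (psnd z) (pfst z))"
  shows "AOP (\<lambda>f x. \<exists>y. P f x y)"
proof -
  have "AO (\<lambda>f x. mu (\<lambda>y. of_bool (P f x y)))"
    using assms unfolding AOP_def by (rule AO_mu)
  then have "AOP (\<lambda>f x. \<not> mu (\<lambda>y. of_bool (P f x y)) = 0)"
    by (intro AOP_not AOP_zero)
  then show ?thesis by (simp add: mu_eq_0_iff)
qed

lemma AOP_all:
  assumes "AOP (\<lambda>f z. P f (psnd z) (pfst z))"
  shows "AOP (\<lambda>f x. \<forall>y. P f x y)"
  using AOP_not[OF AOP_ex[OF AOP_not[OF assms]]] by simp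

lemma AO_if:
  assumes "AOP P" "AO A" "AO B"
  shows "AO (\<lambda>f x. if P f x then A f x else B f x)"
  using AO_case_0[OF AOP_not[OF assms(1), unfolded AOP_def] assms(2,3)]
  by (simp only: of_bool_eq_0_iff not_not)

lemma AOP_if:
  assumes "AOP P" "AOP A" "AOP B"
  shows "AOP (\<lambda>f x. if P f x then A f x else B f x)"
  using AO_if[OF assms(1) assms(2,3)[unfolded AOP_def]]
  by (simp only: AOP_def if_distrib[of of_bool])

lemma AO_of_bool: "AOP P \<Longrightarrow> AO (\<lambda>f x. of_bool (P f x))"
  by (simp add: AOP_def)

lemmas AO_intros = AO_id AO_const AO_oracle AO_Suc AO_pfst AO_psnd AO_pr AO_mu AO_iter
  AO_add AO_mult AO_diff AO_if AO_of_bool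
  AOP_not AOP_conj AOP_disj AOP_imp AOP_iff AOP_less AOP_eq AOP_ex AOP_all AOP_if

section \<open>Arithmetical formulas as operators\<close>

lemma AO_tm_val:
  assumes v: "\<And>i. AO (\<lambda>f x. v f x i)" and K: "AO K"
  shows "AO (\<lambda>f x. tm_val (\<lambda>y. f (pr (K f x) y)) (v f x) \<tau>)"
  by (induction \<tau>) (simp_all add: v K AO_intros)

text \<open>The function variable of the formula is read as column \<open>K f x\<close> of the
  oracle. The column may vary with the input, so one oracle can hold infinitely many
  witnesses.\<close>

lemma AOP_sat:
  assumes "\<And>i. AO (\<lambda>f x. v f x i)" and "AO K"
  shows "AOP (\<lambda>f x. sat (\<lambda>y. f (pr (K f x) y)) (v f x) \<phi>)"
  using assms
proof (induction \<phi> arbitrary: v K)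
  case (Eq s t)
  then show ?case by (simp add: AOP_eq AO_tm_val)
next
  case (Less s t)
  then show ?case by (simp add: AOP_less AO_tm_val)
next
  case (Neg \<phi>)
  then show ?case by (simp add: AOP_not)
next
  case (Conj \<phi> \<psi>)
  then show ?case by (simp add: AOP_conj)
next
  case (Ex i \<phi>)
  have v: "AO (\<lambda>f x. v f (psnd x) j)" for j
    by (rule AO_comp[OF Ex.prems(1)]) (intro AO_intros)
  have K: "AO (\<lambda>f x. K f (psnd x))"
    by (rule AO_comp[OF Ex.prems(2)]) (intro AO_intros)
  have "AO (\<lambda>f x. ((v f (psnd x))(i := pfst x)) j)" for j
    by (cases "j = i") (simp_all add: v AO_intros)
  from Ex.IH[OF this K] show ?case
    unfolding sat.simps by (rule AOP_ex)
qed

text \<open>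
  The analogue of \<open>hyperarithmetical\<close> in terms of operators: \<open>f\<close> is read off uniformly from any
  witness \<open>h\<close>. A value 0 means that \<open>h\<close> is not a witness, all other values are shifted by one. The
  operator \<open>Q\<close> checks the whole witness at every \<open>n\<close>, and this makes closure under operators immediate.
\<close>

definition HD :: "(nat \<Rightarrow> nat) \<Rightarrow> bool" where
  "HD f \<longleftrightarrow> (\<exists>Q. AO Q \<and> (\<exists>h. \<forall>n. Q h n = Suc (f n)) \<and>
     (\<forall>h n. Q h n \<noteq> 0 \<longrightarrow> Q h n = Suc (f n)))"

lemma hyperarithmetical_HD:
  assumes "hyperarithmetical f"
  shows "HD f"
proof -
  obtain \<phi> where "{(n, m). f n = m} = {p. \<exists>g. sat g (inputs p) \<phi>}"
    using assms by (auto simp: hyperarithmetical_def delta11_def sigma11_def)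
  then have \<phi>: "f n = m \<longleftrightarrow> (\<exists>g. sat g (inputs (n, m)) \<phi>)" for n m
    by (auto simp: set_eq_iff)
  \<comment> \<open>Column 0 of \<open>h\<close> guesses \<open>f\<close>, and column
    \<open>Suc k\<close> must witness that the guess at \<open>k\<close> lies on the graph. A guess
    that passes can only be \<open>f\<close>.\<close>
  define Q where "Q h n = (if \<forall>k. sat (\<lambda>y. h (pr (Suc k) y)) (inputs (k, h (pr 0 k))) \<phi>
      then Suc (h (pr 0 n)) else 0)" for h n
  have "AO (\<lambda>f x. inputs (pfst x, f (pr 0 (pfst x))) i)" for i
    by (cases "i = 0"; cases "i = 1") (simp_all add: inputs_def AO_intros)
  then have "AO Q"
    unfolding Q_def by (intro AO_intros AOP_sat)
  moreover have "\<exists>h. \<forall>n. Q h n = Suc (f n)"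
  proof -
    have "\<forall>n. \<exists>g. sat g (inputs (n, f n)) \<phi>"
      using \<phi> by blast
    then obtain G where "\<And>n. sat (G n) (inputs (n, f n)) \<phi>"
      by metis
    then have "\<forall>n. Q (\<lambda>z. if pfst z = 0 then f (psnd z) else G (pfst z - 1) (psnd z)) n = Suc (f n)"
      by (simp add: Q_def)
    then show ?thesis by blast
  qed
  moreover have "f n = h (pr 0 n)" if "Q h n \<noteq> 0" for h n
    using that unfolding \<phi> Q_def by (metis (lifting))
  then have "\<forall>h n. Q h n \<noteq> 0 \<longrightarrow> Q h n = Suc (f n)"
    by (simp add: Q_def)
  ultimately show ?thesis
    unfolding HD_def by blast
qed

lemma HD_AO:
  assumes "HD f" "AO \<Psi>"
  shows "HD (\<Psi> f)"
proof -
  obtain Q h where Q: "AO Q" "\<And>n. Q h n = Suc (f n)" "\<And>h n. Q h n \<noteq> 0 \<Longrightarrow> Q h n = Suc (f n)"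
    using assms(1) unfolding HD_def by blast
  \<comment> \<open>Once every value has passed its check, the decoded function is \<open>f\<close>
    itself, so \<open>\<Psi>\<close> may consult it anywhere.\<close>
  define Q' where "Q' h n = (if \<forall>k. \<not> Q h k = 0 then Suc (\<Psi> (\<lambda>k. Q h k - 1) n) else 0)" for h n
  have "AO Q'"
    unfolding Q'_def
    by (intro AO_intros AO_comp[OF Q(1)] AO_subst[OF assms(2), of "\<lambda>h k. Q h k - 1"] AO_pred Q(1))
  moreover have "Q' h n = Suc (\<Psi> f n)" for n
    by (simp add: Q'_def Q(2))
  moreover have "Q' h n = Suc (\<Psi> f n)" if "Q' h n \<noteq> 0" for h n
  proof -
    have "\<forall>k. Q h k \<noteq> 0"
      using that unfolding Q'_def by presburger
    then have "\<forall>k. Q h k = Suc (f k)"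
      using Q(3) by blast
    then show ?thesis by (simp add: Q'_def)
  qed
  ultimately show ?thesis
    unfolding HD_def by blast
qed

lemma HD_pr:
  assumes "HD f" "HD g"
  shows "HD (\<lambda>n. pr (f n) (g n))"
proof -
  obtain P a where P: "AO P" "\<And>n. P a n = Suc (f n)" "\<And>h n. P h n \<noteq> 0 \<Longrightarrow> P h n = Suc (f n)"
    using assms(1) unfolding HD_def by blast
  obtain Q b where Q: "AO Q" "\<And>n. Q b n = Suc (g n)" "\<And>h n. Q h n \<noteq> 0 \<Longrightarrow> Q h n = Suc (g n)"
    using assms(2) unfolding HD_def by blast
  define P' where "P' h = P (\<lambda>x. pfst (h x))" for h
  define Q' where "Q' h = Q (\<lambda>x. psnd (h x))" for h
  have AOs: "AO P'" "AO Q'"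
    unfolding P'_def Q'_def by (intro AO_subst[OF P(1)] AO_subst[OF Q(1)] AO_intros)+
  define U where "U h n = (if P' h n = 0 \<or> Q' h n = 0 then 0 else Suc (pr (P' h n - 1) (Q' h n - 1)))" for h n
  have "AO U"
    unfolding U_def by (intro AO_intros AO_pred AOs)
  moreover have "U (\<lambda>x. pr (a x) (b x)) n = Suc (pr (f n) (g n))" for n
    by (simp add: U_def P'_def Q'_def P(2) Q(2))
  moreover have "U h n \<noteq> 0 \<longrightarrow> U h n = Suc (pr (f n) (g n))" for h n
    using P(3)[of "\<lambda>x. pfst (h x)" n] Q(3)[of "\<lambda>x. psnd (h x)" n]
    by (auto simp: U_def P'_def Q'_def)
  ultimately show ?thesis
    unfolding HD_def by blast
qed

text \<open>This supplies the enumeration for the diagonal argument. Values are shifted because 0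
  marks a failed witness.\<close>

lemma HD_code:
  assumes "HD f"
  obtains e where "\<And>n i. f n = i \<longleftrightarrow> (\<exists>h. ev h e n = Suc i)"
proof -
  obtain Q h where Q: "AO Q" "\<And>n. Q h n = Suc (f n)" "\<And>h n. Q h n \<noteq> 0 \<Longrightarrow> Q h n = Suc (f n)"
    using assms unfolding HD_def by blast
  then obtain e where e: "\<And>h. ev h e = Q h"
    unfolding AO_def by blast
  have "f n = i \<longleftrightarrow> (\<exists>h. ev h e n = Suc i)" for n i
    unfolding e using Q(2,3) by (metis nat.inject nat.distinct(1))
  then show thesis by (rule that)
qed

section \<open>Kleene computability of arithmetical operators\<close>

text \<open>S6 can only permute, but S9 discards a tail of the arguments. So the wanted arguments
  are permuted to the front, S2 and S4 prepend the index \<open>d\<close>, and S9 runs it on the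
  first \<open>length js\<close> of them.\<close>

lemma kleene_select:
  assumes "kleene d (map ((!) \<Phi>) js) a" "distinct js" "set js \<subseteq> {..<length \<Phi>}" "length \<Phi> = n"
  shows "kleene (list_encode [6, list_encode [4, list_encode [9, length js], list_encode [2, d]],
    list_encode (js @ filter (\<lambda>i. i \<notin> set js) [0..<n])]) \<Phi> a"
proof (rule S6)
  let ?rest = "filter (\<lambda>i. i \<notin> set js) [0..<n]"
  show "distinct (js @ ?rest)" "set (js @ ?rest) = {..<length \<Phi>}"
    using assms(2-4) by auto
  have "kleene (list_encode [9, length (map ((!) \<Phi>) js)])
      (T0 d # map ((!) \<Phi>) js @ map ((!) \<Phi>) ?rest) a"
    by (rule S9) (rule assms(1))
  then have "kleene (list_encode [9, length js]) (T0 d # map ((!) \<Phi>) (js @ ?rest)) a"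
    by (simp only: length_map map_append)
  with S2 show "kleene (list_encode [4, list_encode [9, length js], list_encode [2, d]])
      (map ((!) \<Phi>) (js @ ?rest)) a"
    by (rule S4)
qed

definition env :: "(nat \<Rightarrow> nat) \<Rightarrow> nat list \<Rightarrow> arg list" where
  "env f xs = map T0 xs @ [T1 f, T2 E2]"

lemma length_env [simp]: "length (env f xs) = Suc (Suc (length xs))"
  by (simp add: env_def)

lemma env_Cons: "env f (x # xs) = T0 x # env f xs"
  by (simp add: env_def)

lemma nth_env: "i < length xs \<Longrightarrow> env f xs ! i = T0 (xs ! i)"
  and nth_env_T1: "i = length xs \<Longrightarrow> env f xs ! i = T1 f"
  and nth_env_T2: "i = Suc (length xs) \<Longrightarrow> env f xs ! i = T2 E2"
  by (simp_all add: env_def nth_append)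

definition KC :: "nat \<Rightarrow> ((nat \<Rightarrow> nat) \<Rightarrow> nat list \<Rightarrow> nat) \<Rightarrow> bool" where
  "KC n \<Psi> \<longleftrightarrow> (\<exists>d. \<forall>f xs. length xs = n \<longrightarrow> kleene d (env f xs) (\<Psi> f xs))"

lemma KC_I: "(\<And>f xs. length xs = n \<Longrightarrow> kleene d (env f xs) (\<Psi> f xs)) \<Longrightarrow> KC n \<Psi>"
  by (auto simp: KC_def)

lemma KC_E:
  assumes "KC n \<Psi>"
  obtains d where "\<And>f xs. length xs = n \<Longrightarrow> kleene d (env f xs) (\<Psi> f xs)"
  using assms by (auto simp: KC_def)

lemma KC_cong:
  assumes "KC n \<Psi>" "\<And>f xs. length xs = n \<Longrightarrow> \<Psi> f xs = \<Psi>' f xs"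
  shows "KC n \<Psi>'"
  using assms by (auto simp: KC_def)

lemma KC_const: "KC n (\<lambda>f xs. q)"
  by (rule KC_I) (rule S2)

lemma KC_hd: "KC (Suc n) (\<lambda>f xs. xs ! 0)"
proof (rule KC_I)
  fix f and xs :: "nat list"
  assume "length xs = Suc n"
  then show "kleene (list_encode [3]) (env f xs) (xs ! 0)"
    by (cases xs) (simp_all add: env_Cons S3 del: list_encode.simps)
qed

lemma KC_Suc_hd: "KC (Suc n) (\<lambda>f xs. Suc (xs ! 0))"
proof (rule KC_I)
  fix f and xs :: "nat list"
  assume "length xs = Suc n"
  then show "kleene (list_encode [1]) (env f xs) (Suc (xs ! 0))"
    by (cases xs) (simp_all add: env_Cons S1 del: list_encode.simps One_nat_def)
qed

lemma KC_let:
  assumes "KC n A" "KC (Suc n) B"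
  shows "KC n (\<lambda>f xs. B f (A f xs # xs))"
proof -
  obtain a where a: "\<And>f xs. length xs = n \<Longrightarrow> kleene a (env f xs) (A f xs)"
    using assms(1) by (rule KC_E) blast
  obtain b where b: "\<And>f xs. length xs = Suc n \<Longrightarrow> kleene b (env f xs) (B f xs)"
    using assms(2) by (rule KC_E) blast
  show ?thesis
  proof (rule KC_I)
    fix f and xs :: "nat list"
    assume "length xs = n"
    then have "kleene b (T0 (A f xs) # env f xs) (B f (A f xs # xs))"
      using b[of "A f xs # xs" f] by (simp add: env_Cons)
    with a[OF \<open>length xs = n\<close>] show "kleene (list_encode [4, b, a]) (env f xs) (B f (A f xs # xs))"
      by (rule S4)
  qed
qed

lemma KC_select:
  assumes "KC k A" "distinct js" "set js \<subseteq> {..<n}" "length js = k"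
  shows "KC n (\<lambda>f xs. A f (map ((!) xs) js))"
proof -
  obtain a where a: "\<And>f xs. length xs = k \<Longrightarrow> kleene a (env f xs) (A f xs)"
    using assms(1) by (rule KC_E) blast
  show ?thesis
  proof (rule KC_I)
    fix f and xs :: "nat list"
    assume n: "length xs = n"
    have "map ((!) (env f xs)) (js @ [n, Suc n]) = env f (map ((!) xs) js)"
      using assms(3) n
      by (auto simp: nth_env nth_env_T1 nth_env_T2 subset_iff env_def[of f "map _ _"] intro!: map_cong)
    moreover have "kleene a (env f (map ((!) xs) js)) (A f (map ((!) xs) js))"
      using assms(4) by (intro a) simp
    ultimately have "kleene a (map ((!) (env f xs)) (js @ [n, Suc n])) (A f (map ((!) xs) js))"
      by simp
    from kleene_select[OF this _ _ length_env] assms(2,3) n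
    show "kleene (list_encode [6, list_encode [4, list_encode [9, length (js @ [n, Suc n])],
        list_encode [2, a]], list_encode ((js @ [n, Suc n]) @
        filter (\<lambda>i. i \<notin> set (js @ [n, Suc n])) [0..<Suc (Suc n)])]) (env f xs) (A f (map ((!) xs) js))"
      by (simp add: subset_iff del: list_encode.simps) (metis less_SucI not_less_iff_gr_or_eq)
  qed
qed

lemma KC_nth: "i < n \<Longrightarrow> KC n (\<lambda>f xs. xs ! i)"
  using KC_select[OF KC_hd[of 0], of "[i]" n] by simp

lemma KC_comp:
  assumes "KC 1 (\<lambda>f xs. A f (xs ! 0))" "KC n B"
  shows "KC n (\<lambda>f xs. A f (B f xs))"
  using KC_let[OF assms(2) KC_select[OF assms(1), of "[0]" "Suc n"]] by simp

lemma KC_weaken: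
  assumes "KC n A"
  shows "KC (k + n) (\<lambda>f xs. A f (drop k xs))"
proof (rule KC_cong)
  show "KC (k + n) (\<lambda>f xs. A f (map ((!) xs) [k..<k + n]))"
    using assms by (intro KC_select[of n]) auto
  show "A f (map ((!) xs) [k..<k + n]) = A f (drop k xs)" if "length xs = k + n" for f xs
    using that by (intro arg_cong[of _ _ "A f"] nth_equalityI) auto
qed

lemma KC_comp2:
  assumes "KC 2 (\<lambda>f xs. g (xs ! 0) (xs ! 1))" "KC n B" "KC n C"
  shows "KC n (\<lambda>f xs. g (B f xs) (C f xs))"
proof -
  have "KC (Suc n) (\<lambda>f xs. C f (drop 1 xs))"
    using KC_weaken[OF assms(3), of 1] by simp
  moreover have "KC (Suc (Suc n)) (\<lambda>f xs. g (xs ! 1) (xs ! 0))"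
    using KC_select[OF assms(1), of "[1, 0]" "Suc (Suc n)"] by simp
  ultimately have "KC (Suc n) (\<lambda>f xs. g (xs ! 0) (C f (drop 1 xs)))"
    using KC_let[of "Suc n" "\<lambda>f xs. C f (drop 1 xs)" "\<lambda>f xs. g (xs ! 1) (xs ! 0)"] by simp
  from KC_let[OF assms(2) this] show ?thesis by simp
qed

lemma KC_rec:
  assumes "KC n N" "KC n A" "KC (Suc (Suc n)) (\<lambda>f xs. B f (xs ! 0) (xs ! 1) (drop 2 xs))"
  shows "KC n (\<lambda>f xs. rec_nat (A f xs) (\<lambda>m b. B f m b xs) (N f xs))"
proof -
  obtain p where p: "\<And>f xs. length xs = n \<Longrightarrow> kleene p (env f xs) (N f xs)"
    using assms(1) by (rule KC_E) blast
  obtain a where a: "\<And>f xs. length xs = n \<Longrightarrow> kleene a (env f xs) (A f xs)"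
    using assms(2) by (rule KC_E) blast
  obtain b where b: "\<And>f xs. length xs = Suc (Suc n) \<Longrightarrow>
      kleene b (env f xs) (B f (xs ! 0) (xs ! 1) (drop 2 xs))"
    using assms(3) by (rule KC_E) blast
  show ?thesis
  proof (rule KC_I)
    fix f and xs :: "nat list"
    assume n: "length xs = n"
    let ?r = "rec_nat (A f xs) (\<lambda>m b. B f m b xs)"
    have "kleene (list_encode [5, a, b]) (T0 m # env f xs) (?r m)" for m
    proof (induction m)
      case 0
      from a[OF n] have "kleene (list_encode [5, a, b]) (T0 0 # env f xs) (A f xs)"
        by (rule S5_0)
      then show ?case by (simp del: list_encode.simps)
    next
      case (Suc m)
      have "kleene b (T0 m # T0 (?r m) # env f xs) (?r (Suc m))"
        using b[of "m # ?r m # xs" f] n by (simp add: env_Cons)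
      with Suc show ?case by (rule S5_Suc)
    qed
    then show "kleene (list_encode [4, list_encode [5, a, b], p]) (env f xs) (?r (N f xs))"
      by (rule S4[OF p[OF n]])
  qed
qed

section \<open>Arithmetic and pairing by the schemes\<close>

lemma KC_Suc: "KC n A \<Longrightarrow> KC n (\<lambda>f xs. Suc (A f xs))"
  by (rule KC_comp[of "\<lambda>_. Suc"]) (use KC_Suc_hd[of 0] in simp_all)

lemma KC_add: "KC n A \<Longrightarrow> KC n B \<Longrightarrow> KC n (\<lambda>f xs. A f xs + B f xs)"
proof (rule KC_comp2[where g = "(+)"])
  have "KC 2 (\<lambda>f xs. rec_nat (xs ! 0) (\<lambda>m b. Suc b) (xs ! 1))"
    by (intro KC_rec KC_Suc KC_nth) simp_all
  moreover have "rec_nat a (\<lambda>m b. Suc b) b = a + b" for a b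
    by (induction b) simp_all
  ultimately show "KC 2 (\<lambda>f xs. xs ! 0 + xs ! 1)" by simp
qed

lemma KC_pred: "KC n A \<Longrightarrow> KC n (\<lambda>f xs. A f xs - 1)"
proof (rule KC_comp[where A = "\<lambda>_ a. a - 1"])
  have "KC 1 (\<lambda>f xs. rec_nat 0 (\<lambda>m b. m) (xs ! 0))"
    by (intro KC_rec KC_const KC_nth) simp_all
  moreover have "rec_nat 0 (\<lambda>m b. m) a = a - 1" for a :: nat
    by (cases a) simp_all
  ultimately show "KC 1 (\<lambda>f xs. xs ! 0 - 1)" by simp
qed

lemma KC_diff: "KC n A \<Longrightarrow> KC n B \<Longrightarrow> KC n (\<lambda>f xs. A f xs - B f xs)"
proof (rule KC_comp2[where g = "(-)"])
  have "KC 2 (\<lambda>f xs. rec_nat (xs ! 0) (\<lambda>m b. b - 1) (xs ! 1))"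
    by (intro KC_rec KC_pred KC_nth) simp_all
  moreover have "rec_nat a (\<lambda>m b. b - 1) b = a - b" for a b :: nat
    by (induction b) simp_all
  ultimately show "KC 2 (\<lambda>f xs. xs ! 0 - xs ! 1)" by simp
qed

lemma KC_triangle: "KC n A \<Longrightarrow> KC n (\<lambda>f xs. triangle (A f xs))"
proof (rule KC_comp[where A = "\<lambda>_. triangle"])
  have "KC 1 (\<lambda>f xs. rec_nat 0 (\<lambda>m b. b + Suc m) (xs ! 0))"
    by (intro KC_rec KC_add KC_Suc KC_const KC_nth) simp_all
  moreover have "rec_nat 0 (\<lambda>m b. b + Suc m) a = triangle a" for a
    by (induction a) simp_all
  ultimately show "KC 1 (\<lambda>f xs. triangle (xs ! 0))" by simp
qed

lemma KC_pr: "KC n A \<Longrightarrow> KC n B \<Longrightarrow> KC n (\<lambda>f xs. pr (A f xs) (B f xs))"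
  unfolding pr_def prod_encode_def by (simp add: KC_add KC_triangle)

lemma triangle_mono: "m \<le> n \<Longrightarrow> triangle m \<le> triangle n"
  unfolding triangle_def by (intro div_le_mono mult_le_mono) auto

lemma KC_diagonal: "KC n A \<Longrightarrow> KC n (\<lambda>f xs. pfst (A f xs) + psnd (A f xs))"
proof (rule KC_comp[where A = "\<lambda>_ a. pfst a + psnd a"])
  \<comment> \<open>The diagonal containing \<open>x\<close> is the largest \<open>k\<close> with
    \<open>triangle k \<le> x\<close>. The summand is 1 if
    \<open>triangle (Suc b) \<le> Suc m\<close> and 0 otherwise.\<close>
  define k where "k = rec_nat 0 (\<lambda>m b. b + (1 - (triangle (Suc b) - Suc m)))"
  have "KC 1 (\<lambda>f xs. k (xs ! 0))"
    unfolding k_def by (intro KC_rec KC_add KC_diff KC_triangle KC_Suc KC_const KC_nth) simp_all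
  moreover have "k x = pfst x + psnd x" for x
  proof -
    have "k 0 = 0" "k (Suc x) = (if triangle (Suc (k x)) \<le> Suc x then Suc (k x) else k x)" for x
      by (auto simp: k_def)
    then have k: "triangle (k x) \<le> x \<and> x < triangle (Suc (k x))"
      by (induction x) auto
    have x: "x = triangle (pfst x + psnd x) + pfst x"
      using pr_eta[of x] by (simp add: pr_def prod_encode_def)
    have "\<not> Suc (k x) \<le> pfst x + psnd x" "\<not> Suc (pfst x + psnd x) \<le> k x"
      using k x triangle_mono[of "Suc (k x)" "pfst x + psnd x"]
        triangle_mono[of "Suc (pfst x + psnd x)" "k x"] by auto
    then show ?thesis by linarith
  qed
  ultimately show "KC 1 (\<lambda>f xs. pfst (xs ! 0) + psnd (xs ! 0))" by simp
qed

lemma KC_pfst: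
  assumes "KC n A"
  shows "KC n (\<lambda>f xs. pfst (A f xs))"
proof -
  have "pfst x = x - triangle (pfst x + psnd x)" for x
    using pr_eta[of x] by (simp add: pr_def prod_encode_def)
  then show ?thesis
    using KC_diff[OF assms KC_triangle[OF KC_diagonal[OF assms]]] by simp
qed

lemma KC_psnd:
  assumes "KC n A"
  shows "KC n (\<lambda>f xs. psnd (A f xs))"
  using KC_diff[OF KC_diagonal[OF assms] KC_pfst[OF assms]] by simp

lemma KC_app:
  assumes "KC n A"
  shows "KC n (\<lambda>f xs. f (A f xs))"
proof -
  have "KC 1 (\<lambda>f xs. f (xs ! 0))"
  proof (rule KC_I)
    fix f and xs :: "nat list"
    assume "length xs = 1"
    then obtain x where xs: "xs = [x]"
      by (cases xs) auto
    have "kleene (list_encode [7]) (map ((!) (env f xs)) [1, 0]) (f (xs ! 0))"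
      using S7[of f x "[]"] by (simp add: xs env_def del: list_encode.simps)
    from kleene_select[OF this, of 3]
    show "kleene (list_encode [6, list_encode [4, list_encode [9, length [1 :: nat, 0]],
        list_encode [2, list_encode [7]]], list_encode ([1, 0] @
        filter (\<lambda>i. i \<notin> set [1, 0]) [0..<3])]) (env f xs) (f (xs ! 0))"
      by (simp add: xs del: list_encode.simps)
  qed
  then show ?thesis
    using assms by (rule KC_comp)
qed

lemma map_nth_middle:
  "map ((!) (us @ vs @ ws)) [length us..<length us + length vs] = vs"
  by (intro nth_equalityI) (simp_all add: nth_append)

lemma KC_E2:
  assumes "KC (Suc n) A"
  shows "KC n (\<lambda>f xs. E2 (\<lambda>y. A f (y # xs)))"
proof -
  obtain a where a: "\<And>f xs. length xs = Suc n \<Longrightarrow> kleene a (env f xs) (A f xs)"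
    using assms by (rule KC_E) blast
  \<comment> \<open>S8 puts the bound number and then the functional first, while \<open>a\<close>
    expects the functional last. Inside S8, \<open>js\<close> restores that order; outside,
    \<open>ks\<close> brings \<open>E2\<close> to the front.\<close>
  define js where "js = 0 # [2..<n + 3] @ [1]"
  define ks where "ks = Suc n # [0..<Suc n]"
  define b where "b = list_encode [6, list_encode [4, list_encode [9, length js], list_encode [2, a]],
    list_encode (js @ filter (\<lambda>i. i \<notin> set js) [0..<n + 3])]"
  define c where "c = list_encode [8, b]"
  show ?thesis
  proof (rule KC_I)
    fix f and xs :: "nat list"
    assume n: "length xs = n"
    have "kleene b (T0 y # T2 E2 # map T0 xs @ [T1 f]) (A f (y # xs))" for y
      unfolding b_def
    proof (rule kleene_select)
      have "map ((!) (T0 y # T2 E2 # map T0 xs @ [T1 f])) [2..<n + 3] = map T0 xs @ [T1 f]"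
        using map_nth_middle[of "[T0 y, T2 E2]" "map T0 xs @ [T1 f]" "[]"] n
        by (simp add: numeral_2_eq_2 numeral_3_eq_3 del: upt_Suc)
      then have "map ((!) (T0 y # T2 E2 # map T0 xs @ [T1 f])) js = env f (y # xs)"
        by (simp add: js_def env_def del: upt_Suc)
      then show "kleene a (map ((!) (T0 y # T2 E2 # map T0 xs @ [T1 f])) js) (A f (y # xs))"
        using a[of "y # xs" f] n by simp
    qed (use n in \<open>auto simp: js_def\<close>)
    then have c: "kleene c (T2 E2 # map T0 xs @ [T1 f]) (E2 (\<lambda>y. A f (y # xs)))"
      unfolding c_def by (rule S8)
    show "kleene (list_encode [6, list_encode [4, list_encode [9, length ks], list_encode [2, c]],
        list_encode (ks @ filter (\<lambda>i. i \<notin> set ks) [0..<n + 2])]) (env f xs)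
        (E2 (\<lambda>y. A f (y # xs)))"
    proof (rule kleene_select)
      have "map ((!) (env f xs)) [0..<Suc n] = map T0 xs @ [T1 f]"
        using map_nth_middle[of "[]" "map T0 xs @ [T1 f]" "[T2 E2]"] n
        by (simp add: env_def del: upt_Suc)
      then have "map ((!) (env f xs)) ks = T2 E2 # map T0 xs @ [T1 f]"
        using n by (simp add: ks_def nth_env_T2 del: upt_Suc)
      with c show "kleene c (map ((!) (env f xs)) ks) (E2 (\<lambda>y. A f (y # xs)))"
        by simp
    qed (use n in \<open>auto simp: ks_def\<close>)
  qed
qed

lemma KC_test:
  assumes "KC n A"
  shows "KC n (\<lambda>f xs. if A f xs = 0 then 1 else 0)"
proof (rule KC_cong)
  show "KC n (\<lambda>f xs. 1 - A f xs)"
    by (intro KC_diff KC_const assms)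
qed simp

text \<open>
  The search procedure receives its own index as first argument and calls itself through S9. S5
  serves as a lazy conditional: its base case is always evaluated, so the recursive call must sit
  in the successor case.
\<close>

lemma KC_mu:
  assumes "KC (Suc n) A"
  shows "KC n (\<lambda>f xs. mu (\<lambda>y. A f (y # xs)))"
proof -
  have "KC (Suc (Suc n)) (\<lambda>f xs. A f (drop 1 xs))"
    using KC_weaken[OF assms, of 1] by simp
  from KC_test[OF this] obtain c where c: "\<And>f xs. length xs = Suc (Suc n) \<Longrightarrow>
      kleene c (env f xs) (if A f (drop 1 xs) = 0 then 1 else 0)"
    by (rule KC_E) blast
  have "KC (Suc (Suc n)) (\<lambda>f xs. Suc (xs ! 1))"
    by (intro KC_Suc KC_nth) simp
  then obtain b where b: "\<And>f xs. length xs = Suc (Suc n) \<Longrightarrow> kleene b (env f xs) (Suc (xs ! 1))"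
    by (rule KC_E) blast
  have "KC (n + 4) (\<lambda>f xs. Suc (xs ! 3))"
    by (intro KC_Suc KC_nth) simp
  then obtain s where s: "\<And>f xs. length xs = n + 4 \<Longrightarrow> kleene s (env f xs) (Suc (xs ! 3))"
    by (rule KC_E) blast
  have "KC (n + 5) (\<lambda>f xs. xs ! 3)"
    by (intro KC_nth) simp
  then obtain p where p: "\<And>f xs. length xs = n + 5 \<Longrightarrow> kleene p (env f xs) (xs ! 3)"
    by (rule KC_E) blast
  \<comment> \<open>The call finds \<open>m, Suc y, 0, u, m, y\<close> in front of
    \<open>xs\<close>. Kept are the index for S9, the index as an argument, the next candidate and
    everything from \<open>xs\<close> on.\<close>
  define js where "js = [0, 4, 1] @ [6..<n + 8]"
  define call where "call = list_encode [6, list_encode [4, list_encode [9, length js],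
    list_encode [2, list_encode [9, n + 4]]],
    list_encode (js @ filter (\<lambda>i. i \<notin> set js) [0..<n + 8])]"
  define nxt where "nxt = list_encode [4, list_encode [4, call, p], s]"
  define m where "m = list_encode [4, list_encode [5, b, nxt], c]"
  have nxt: "kleene nxt (T0 0 # T0 u # env f (m # y # xs)) v"
    if n: "length xs = n" and v: "kleene m (env f (m # Suc y # xs)) v" for f xs u y v
    unfolding nxt_def
  proof (rule S4)
    show "kleene s (T0 0 # T0 u # env f (m # y # xs)) (Suc y)"
      using s[of "0 # u # m # y # xs" f] n by (simp add: env_Cons)
    show "kleene (list_encode [4, call, p]) (T0 (Suc y) # T0 0 # T0 u # env f (m # y # xs)) v"
    proof (rule S4)
      show "kleene p (T0 (Suc y) # T0 0 # T0 u # env f (m # y # xs)) m"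
        using p[of "Suc y # 0 # u # m # y # xs" f] n by (simp add: env_Cons)
      let ?ys = "[m, Suc y, 0, u, m, y] @ xs"
      have "kleene call (env f ?ys) v"
        unfolding call_def
      proof (rule kleene_select)
        have "map ((!) (env f ?ys)) [6..<n + 8] = env f xs"
          using map_nth_middle[of "map T0 [m, Suc y, 0, u, m, y]" "env f xs" "[]"] n
          by (simp add: env_Cons eval_nat_numeral del: upt_Suc)
        then have js: "map ((!) (env f ?ys)) js = T0 m # env f (m # Suc y # xs)"
          by (simp add: js_def env_Cons del: upt_Suc)
        have "kleene (list_encode [9, length (env f (m # Suc y # xs))])
            (T0 m # env f (m # Suc y # xs) @ []) v"
          by (rule S9) (rule v)
        then show "kleene (list_encode [9, n + 4]) (map ((!) (env f ?ys)) js) v"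
          unfolding js using n by (simp add: eval_nat_numeral del: list_encode.simps)
      qed (use n in \<open>auto simp: js_def\<close>)
      then show "kleene call (T0 m # T0 (Suc y) # T0 0 # T0 u # env f (m # y # xs)) v"
        by (simp add: env_Cons)
    qed
  qed
  \<comment> \<open>The induction runs downwards from the success at \<open>y0\<close>: a
    computation started at \<open>Suc y\<close> is extended to one started at
    \<open>y\<close>.\<close>
  have search: "kleene m (env f (m # y # xs)) (Suc y0)"
    if n: "length xs = n" and y0: "A f (y0 # xs) \<noteq> 0" "\<forall>y<y0. A f (y # xs) = 0" and "y \<le> y0"
    for f xs y y0
    using \<open>y \<le> y0\<close>
  proof (induction y rule: inc_induct)
    case base
    have "kleene c (env f (m # y0 # xs)) 0"
      using c[of "m # y0 # xs" f] n y0(1) by simp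
    moreover have "kleene b (env f (m # y0 # xs)) (Suc y0)"
      using b[of "m # y0 # xs" f] n by simp
    then have "kleene (list_encode [5, b, nxt]) (T0 0 # env f (m # y0 # xs)) (Suc y0)"
      by (rule S5_0)
    ultimately show ?case
      unfolding m_def by (rule S4)
  next
    case (step y)
    have "kleene c (env f (m # y # xs)) (Suc 0)"
      using c[of "m # y # xs" f] n y0(2) step.hyps by simp
    moreover have "kleene b (env f (m # y # xs)) (Suc y)"
      using b[of "m # y # xs" f] n by simp
    then have "kleene (list_encode [5, b, nxt]) (T0 0 # env f (m # y # xs)) (Suc y)"
      by (rule S5_0)
    from this nxt[OF n step.IH]
    have "kleene (list_encode [5, b, nxt]) (T0 (Suc 0) # env f (m # y # xs)) (Suc y0)"
      by (rule S5_Suc)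
    ultimately show ?case
      using m_def S4 by metis
  qed
  define ks where "ks = [0, 1] @ [4..<n + 6]"
  define sel where "sel = list_encode [6, list_encode [4, list_encode [9, length ks],
    list_encode [2, m]], list_encode (ks @ filter (\<lambda>i. i \<notin> set ks) [0..<n + 6])]"
  define go where "go = list_encode [4, list_encode [4, sel, list_encode [2, m]], list_encode [2, 0]]"
  have go: "kleene go (T0 0 # T0 0 # env f xs) v"
    if n: "length xs = n" and v: "kleene m (env f (m # 0 # xs)) v" for f xs v
    unfolding go_def
  proof (rule S4[OF S2 S4[OF S2]])
    have "kleene sel (env f ([m, 0, 0, 0] @ xs)) v"
      unfolding sel_def
    proof (rule kleene_select)
      have "map ((!) (env f ([m, 0, 0, 0] @ xs))) [4..<n + 6] = env f xs"
        using map_nth_middle[of "map T0 [m, 0, 0, 0]" "env f xs" "[]"] n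
        by (simp add: env_Cons eval_nat_numeral del: upt_Suc)
      then show "kleene m (map ((!) (env f ([m, 0, 0, 0] @ xs))) ks) v"
        using v by (simp add: ks_def env_Cons del: upt_Suc)
    qed (use n in \<open>auto simp: ks_def\<close>)
    then show "kleene sel (T0 m # T0 0 # T0 0 # T0 0 # env f xs) v"
      by (simp add: env_Cons)
  qed
  \<comment> \<open>\<open>E2\<close> first decides whether the search succeeds. The outer S5 enters
    the search only in that case, so a value is always obtained.\<close>
  have "KC n (\<lambda>f xs. 1 - E2 (\<lambda>y. if A f (y # xs) = 0 then 1 else 0))"
    by (intro KC_diff KC_const KC_E2[OF KC_test[OF assms]])
  then obtain e where e: "\<And>f xs. length xs = n \<Longrightarrow>
      kleene e (env f xs) (1 - E2 (\<lambda>y. if A f (y # xs) = 0 then 1 else 0))"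
    by (rule KC_E) blast
  define z where "z = list_encode [2, 0]"
  show ?thesis
  proof (rule KC_I)
    fix f and xs :: "nat list"
    assume n: "length xs = n"
    let ?h = "\<lambda>y. A f (y # xs)"
    have z: "kleene (list_encode [5, z, go]) (T0 0 # env f xs) 0"
      unfolding z_def by (rule S5_0) (rule S2)
    show "kleene (list_encode [4, list_encode [5, z, go], e]) (env f xs) (mu ?h)"
    proof (cases "mu ?h")
      case 0
      then have "kleene e (env f xs) 0"
        using e[OF n, of f] by (simp add: mu_eq_0_iff E2_def)
      then show ?thesis
        unfolding 0 using z by (rule S4)
    next
      case (Suc y0)
      then have y0: "?h y0 \<noteq> 0" "\<forall>y<y0. ?h y = 0"
        by (simp_all add: mu_eq_Suc_iff)
      then have "E2 (\<lambda>y. if ?h y = 0 then 1 else 0) = 0"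
        by (auto simp: E2_def)
      then have "kleene e (env f xs) (Suc 0)"
        using e[OF n, of f] by simp
      moreover have "kleene (list_encode [5, z, go]) (T0 (Suc 0) # env f xs) (mu ?h)"
        unfolding Suc using z go[OF n search[OF n y0]] by (intro S5_Suc[where b = 0]) simp_all
      ultimately show ?thesis
        by (rule S4)
    qed
  qed
qed

lemma AO_KC:
  assumes "AO \<Psi>"
  shows "KC 1 (\<lambda>f xs. \<Psi> f (xs ! 0))"
  using assms
proof (induction rule: AO_induct)
  case arg
  show ?case by (intro KC_app KC_nth) simp
next
  case Suc
  show ?case by (intro KC_Suc KC_nth) simp
next
  case fst
  show ?case by (intro KC_pfst KC_nth) simp
next
  case snd
  show ?case by (intro KC_psnd KC_nth) simp
next
  case (pair A B)
  then show ?case by (rule KC_pr)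
next
  case (comp A B)
  then show ?case by (rule KC_comp)
next
  case (iter A)
  have "KC 1 (\<lambda>f xs. rec_nat (psnd (xs ! 0)) (\<lambda>m b. A f b) (pfst (xs ! 0)))"
    by (intro KC_rec KC_comp[OF iter.IH] KC_pfst KC_psnd KC_nth) simp_all
  moreover have "rec_nat x (\<lambda>m b. g b) n = (g ^^ n) x" for g :: "nat \<Rightarrow> nat" and x n
    by (induction n) simp_all
  ultimately show ?case by simp
next
  case (mu A)
  have "KC 2 (\<lambda>f xs. A f (pr (xs ! 0) (xs ! 1)))"
    by (intro KC_comp[OF mu.IH] KC_pr KC_nth) simp_all
  then show ?case
    using KC_mu[of 1 "\<lambda>f xs. A f (pr (xs ! 0) (xs ! 1))"] by (simp add: numeral_2_eq_2)
qed

lemma AO_kleene: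
  assumes "AO \<Psi>"
  shows "\<exists>e. \<forall>f. kleene e [T1 f, T2 E2] (\<Psi> f 0)"
proof -
  obtain d where d: "\<And>f xs. length xs = 1 \<Longrightarrow> kleene d (env f xs) (\<Psi> f (xs ! 0))"
    using AO_KC[OF assms] by (rule KC_E) blast
  have "kleene (list_encode [4, d, list_encode [2, 0]]) [T1 f, T2 E2] (\<Psi> f 0)" for f
    using d[of "[0]" f] by (intro S4[OF S2]) (simp add: env_def)
  then show ?thesis by blast
qed

section \<open>Trees of approximations to evaluation tables\<close>

text \<open>
  A function \<open>g\<close> is an evaluation table if \<open>g (pr t x)\<close> is the value of code \<open>t\<close> at \<open>x\<close>. The entry at
  \<open>pr t x\<close> is checked against the entry at \<open>inner_pos t x\<close>, whose value is \<open>C\<close>, and then against the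
  entry at \<open>outer_pos t x C\<close>, whose value is \<open>D\<close>. For \<open>mu\<close> the entry checked is the one at \<open>pr t (psnd x)\<close>,
  and \<open>pfst x\<close> is the candidate.
\<close>

definition inner_pos :: "nat \<Rightarrow> nat \<Rightarrow> nat" where
  "inner_pos t x = (if opc t = 5 then pr t (pr (pfst x - 1) (psnd x))
     else if 5 < opc t then pr t (psnd x) else pr (rgt t) x)"

definition outer_pos :: "nat \<Rightarrow> nat \<Rightarrow> nat \<Rightarrow> nat" where
  "outer_pos t x C = pr (lft t) (if opc t = 4 \<or> opc t = 5 then C else x)"

definition clause :: "nat \<Rightarrow> nat \<Rightarrow> nat \<Rightarrow> nat \<Rightarrow> nat \<Rightarrow> bool" where
  "clause t x A C D \<longleftrightarrow>
    (if opc t = 0 then A = Suc x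
     else if opc t = 1 then A = pfst x
     else if opc t = 2 then A = psnd x
     else if opc t = 3 then A = pr D C
     else if opc t = 4 then A = D
     else if opc t = 5 then A = (if pfst x = 0 then psnd x else D)
     else (C = Suc (pfst x) \<longrightarrow> D \<noteq> 0) \<and> (C = 0 \<or> Suc (pfst x) < C \<longrightarrow> D = 0))"

definition satisfies :: "(nat \<Rightarrow> nat) \<Rightarrow> nat \<Rightarrow> nat \<Rightarrow> bool" where
  "satisfies g t x \<longleftrightarrow> t = 0 \<or> clause t x (g (pr t x)) (g (inner_pos t x)) (g (outer_pos t x (g (inner_pos t x))))"

lemma satisfies_cong:
  assumes "g (pr t x) = g' (pr t x)" "g (inner_pos t x) = g' (inner_pos t x)"
    "g (outer_pos t x (g (inner_pos t x))) = g' (outer_pos t x (g (inner_pos t x)))"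
  shows "satisfies g t x \<longleftrightarrow> satisfies g' t x"
  using assms by (simp add: satisfies_def)

text \<open>The clauses determine the entries of \<open>t\<close> from those of its smaller
  subcodes, with an inner induction on the count for iteration. For search, the clauses for all
  candidates together force the value of \<open>mu\<close>.\<close>

lemma table_eq_ev:
  assumes "\<And>t x. satisfies g t x"
  shows "g (pr t x) = ev (\<lambda>x. g (pr 0 x)) t x"
proof (induction t arbitrary: x rule: less_induct)
  case (less t)
  let ?h = "\<lambda>x. g (pr 0 x)"
  show ?case
  proof (cases "t = 0")
    case True
    then show ?thesis by simp
  next
    case False
    have l: "g (pr (lft t) y) = ev ?h (lft t) y" and r: "g (pr (rgt t) y) = ev ?h (rgt t) y" for y
      using False less lft_less rgt_less by blast+
    have R: "clause t y (g (pr t y)) (g (inner_pos t y)) (g (outer_pos t y (g (inner_pos t y))))" for y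
      using assms[of t y] False by (simp add: satisfies_def)
    consider "opc t < 5" | "opc t = 5" | "5 < opc t" by linarith
    then show ?thesis
    proof cases
      case 1
      then show ?thesis
        using R[of x] False
        by (auto simp: clause_def inner_pos_def outer_pos_def l r ev.simps[of ?h t])
    next
      case 2
      have "g (pr t (pr n y)) = (ev ?h (lft t) ^^ n) y" for n y
      proof (induction n)
        case 0
        then show ?case using R[of "pr 0 y"] 2 by (simp add: clause_def)
      next
        case (Suc n)
        then show ?case using R[of "pr (Suc n) y"] 2 by (simp add: clause_def inner_pos_def outer_pos_def l)
      qed
      from this[of "pfst x" "psnd x"] show ?thesis
        using 2 False by (simp add: ev.simps[of ?h t])
    next
      case 3
      let ?C = "g (pr t x)" and ?D = "\<lambda>y. ev ?h (lft t) (pr y x)"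
      have D: "(?C = Suc y \<longrightarrow> ?D y \<noteq> 0) \<and> (?C = 0 \<or> Suc y < ?C \<longrightarrow> ?D y = 0)" for y
        using R[of "pr y x"] 3 by (simp add: clause_def inner_pos_def outer_pos_def l)
      have "?C = mu ?D"
      proof (cases ?C)
        case 0
        then show ?thesis using D mu_eq_0_iff[of ?D] by simp
      next
        case (Suc n)
        then show ?thesis using D mu_eq_Suc_iff[of ?D n] by simp
      qed
      then show ?thesis
        using 3 False by (simp add: ev.simps[of ?h t])
    qed
  qed
qed

lemma satisfies_ev: "satisfies (\<lambda>p. ev h (pfst p) (psnd p)) t x"
proof (cases "t = 0")
  case False
  consider "opc t < 5" | "opc t = 5" | "5 < opc t" by linarith
  then show ?thesis
  proof cases
    case 1
    then show ?thesis
      using False by (auto simp: satisfies_def clause_def inner_pos_def outer_pos_def ev.simps[of h t])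
  next
    case 2
    then show ?thesis
      using False by (cases "pfst x") (auto simp: satisfies_def clause_def inner_pos_def outer_pos_def ev.simps[of h t])
  next
    case 3
    let ?D = "\<lambda>y. ev h (lft t) (pr y (psnd x))"
    have "ev h t (psnd x) = mu ?D"
      using 3 False by (simp add: ev.simps[of h t])
    moreover have "(mu D = Suc p \<longrightarrow> D p \<noteq> 0) \<and> (mu D = 0 \<or> Suc p < mu D \<longrightarrow> D p = 0)" for D p
      using mu_eq_0_iff[of D] mu_eq_Suc_iff[of D] by (cases "mu D") auto
    from this[of ?D "pfst x"]
    have "(mu ?D = Suc (pfst x) \<longrightarrow> ev h (lft t) x \<noteq> 0) \<and>
        (mu ?D = 0 \<or> Suc (pfst x) < mu ?D \<longrightarrow> ev h (lft t) x = 0)"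
      by simp
    ultimately show ?thesis
      using 3 False by (simp add: satisfies_def clause_def inner_pos_def outer_pos_def)
  qed
qed (simp add: satisfies_def)

text \<open>
  A node \<open>s\<close> is a pair of a length \<open>pfst s\<close> and a code of that many values. The codes are not unique,
  and \<open>extends\<close> allows any positive number of new values.
\<close>

definition val :: "nat \<Rightarrow> nat \<Rightarrow> nat" where
  "val s p = pfst ((psnd ^^ p) (psnd s))"

definition extends :: "nat \<Rightarrow> nat \<Rightarrow> bool" where
  "extends s s' \<longleftrightarrow> pfst s < pfst s' \<and> (\<forall>p<pfst s. val s' p = val s p)"

definition approx :: "(nat \<Rightarrow> nat) \<Rightarrow> nat \<Rightarrow> bool" where
  "approx g s \<longleftrightarrow> (\<forall>p<pfst s. val s p = g p)"

text \<open>Only entries whose three look-ups lie below the length are checked, so a finite part of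
  a true table always passes. Infinite branches yield oracles \<open>h\<close> with
  \<open>ev h e a = b\<close>, and conversely.\<close>

definition tree :: "nat \<Rightarrow> nat \<Rightarrow> nat \<Rightarrow> nat \<Rightarrow> bool" where
  "tree e a b s \<longleftrightarrow>
    (\<forall>t x. pr t x < pfst s \<and> inner_pos t x < pfst s \<and> outer_pos t x (val s (inner_pos t x)) < pfst s \<longrightarrow> satisfies (val s) t x) \<and>
    (pr e a < pfst s \<longrightarrow> val s (pr e a) = b)"

lemma extends_trans: "extends s s' \<Longrightarrow> extends s' s'' \<Longrightarrow> extends s s''"
  unfolding extends_def by (metis less_trans)

lemma approx_0: "approx g 0"
  by (simp add: approx_def)

lemma approx_exists: "\<exists>s. pfst s = n \<and> approx g s"
proof -
  have "\<exists>l. \<forall>p<n. pfst ((psnd ^^ p) l) = g p"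
  proof (induction n arbitrary: g)
    case (Suc n)
    from Suc[of "\<lambda>p. g (Suc p)"] obtain l where l: "\<forall>p<n. pfst ((psnd ^^ p) l) = g (Suc p)"
      by blast
    have "pfst ((psnd ^^ p) (pr (g 0) l)) = g p" if "p < Suc n" for p
      using that l by (cases p) (auto simp: funpow_swap1)
    then show ?case by blast
  qed simp
  then obtain l where "\<forall>p<n. pfst ((psnd ^^ p) l) = g p" ..
  then have "pfst (pr n l) = n \<and> approx g (pr n l)"
    by (simp add: approx_def val_def)
  then show ?thesis by blast
qed

lemma approx_extend:
  assumes "approx g s"
  obtains s' where "approx g s'" "extends s s'"
proof -
  obtain s' where "pfst s' = Suc (pfst s)" "approx g s'"
    using approx_exists by blast
  moreover from this have "extends s s'"
    using assms by (simp add: approx_def extends_def)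
  ultimately show thesis
    using that by blast
qed

lemma approx_tree:
  assumes "approx (\<lambda>p. ev h (pfst p) (psnd p)) s" "ev h e a = b"
  shows "tree e a b s"
proof -
  let ?g = "\<lambda>p. ev h (pfst p) (psnd p)"
  have v: "val s p = ?g p" if "p < pfst s" for p
    using assms(1) that by (simp add: approx_def)
  have "satisfies (val s) t x" if "pr t x < pfst s" "inner_pos t x < pfst s" "outer_pos t x (val s (inner_pos t x)) < pfst s" for t x
    using satisfies_ev[of h t x] satisfies_cong[where g = "val s" and g' = ?g and t = t and x = x, OF that[THEN v]] by blast
  moreover have "pr e a < pfst s \<longrightarrow> val s (pr e a) = b"
    using assms(2) by (simp add: v)
  ultimately show ?thesis
    unfolding tree_def by blast
qed

text \<open>Lengths grow strictly, so entry \<open>p\<close> is final from node \<open>Suc p\<close>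
  on and every check is eventually in range. The oracle is written out explicitly to show that it is
  arithmetical in the branch.\<close>

lemma tree_limit:
  assumes ext: "\<And>n. extends (s n) (s (Suc n))" and T: "\<And>n. tree e a b (s (Suc n))"
  shows "ev (\<lambda>x. val (s (Suc (pr 0 x))) (pr 0 x)) e a = b"
proof -
  define g where "g p = val (s (Suc p)) p" for p
  have len: "n \<le> pfst (s n)" for n
  proof (induction n)
    case (Suc n)
    with ext[of n] show ?case by (simp add: extends_def)
  qed simp
  have agree: "p < pfst (s n) \<Longrightarrow> p < pfst (s m) \<and> val (s m) p = val (s n) p" if "n \<le> m" for n m p
    using that
  proof (induction m rule: dec_induct)
    case (step m)
    then show ?case using ext[of m] by (auto simp: extends_def)
  qed simp
  have g: "val (s m) p = g p" if "p < m" for p m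
    unfolding g_def using agree[of "Suc p" m p] len[of "Suc p"] that by auto
  have "satisfies g t x" for t x
  proof -
    define m where "m = Suc (max (pr t x) (max (inner_pos t x) (outer_pos t x (g (inner_pos t x)))))"
    have m: "pr t x < m" "inner_pos t x < m" "outer_pos t x (g (inner_pos t x)) < m"
      unfolding m_def by linarith+
    note eq = m[THEN g]
    have "tree e a b (s m)"
      using T[of "m - 1"] by (simp add: m_def)
    moreover have "pr t x < pfst (s m)" "inner_pos t x < pfst (s m)" "outer_pos t x (val (s m) (inner_pos t x)) < pfst (s m)"
      unfolding eq(2) using m len[of m] by linarith+
    ultimately have "satisfies (val (s m)) t x"
      unfolding tree_def by blast
    moreover have "satisfies (val (s m)) t x \<longleftrightarrow> satisfies g t x"
      using eq by (intro satisfies_cong) simp_all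
    ultimately show ?thesis by blast
  qed
  then have "ev (\<lambda>x. g (pr 0 x)) e a = g (pr e a)"
    using table_eq_ev[of g e a] by simp
  also have "g (pr e a) = b"
    using T[of "pr e a"] len[of "Suc (pr e a)"] by (simp add: tree_def g_def)
  finally show ?thesis by (simp only: g_def)
qed

lemma tree_chain:
  assumes "P x0" and "\<And>x. P x \<Longrightarrow> \<exists>y. P y \<and> extends (\<tau> x) (\<tau> y) \<and> tree e a b (\<tau> y)"
  shows "\<exists>h. ev h e a = b"
proof -
  obtain Y where Y: "\<And>n. P (Y n)" "\<And>n. extends (\<tau> (Y n)) (\<tau> (Y (Suc n))) \<and> tree e a b (\<tau> (Y (Suc n)))"
    using dependent_nat_choice[of "\<lambda>_. P" "\<lambda>_ x y. extends (\<tau> x) (\<tau> y) \<and> tree e a b (\<tau> y)"] assms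
    by metis
  then show ?thesis
    using tree_limit[of "\<lambda>n. \<tau> (Y n)" e a b] by blast
qed

section \<open>The game\<close>

text \<open>
  Whether the first player can win from the position \<open>(s, t, r)\<close>, given the evaluation \<open>v\<close>. The first
  player extends \<open>s\<close> towards a table in which code \<open>e\<close> has value 2 at \<open>e\<close>, that is \<open>{e}(e) = 1\<close>; the
  second player extends \<open>t\<close> towards one with value 1, and extends \<open>r\<close> in \<open>S\<close>.
\<close>

definition move :: "(nat \<Rightarrow> bool) \<Rightarrow> (nat \<Rightarrow> nat) \<Rightarrow> nat \<Rightarrow> nat \<Rightarrow> nat \<Rightarrow> nat \<Rightarrow> bool" where
  "move S v e s t r \<longleftrightarrow> (\<exists>s'. extends s s' \<and> tree e e 2 s' \<and>
     (\<forall>t' r'. extends t t' \<and> tree e e 1 t' \<and> extends r r' \<and> S r' \<longrightarrow>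
        v (pr e (pr s' (pr t' r'))) \<noteq> 0))"

definition clock :: "nat \<Rightarrow> nat" where
  "clock x = psnd (psnd (psnd x))"

definition step :: "(nat \<Rightarrow> bool) \<Rightarrow> (nat \<Rightarrow> nat) \<Rightarrow> nat \<Rightarrow> bool" where
  "step S v x \<longleftrightarrow> move S v (pfst x) (pfst (psnd x)) (pfst (psnd (psnd x))) (clock x)"

lemma step_pr [simp]: "step S v (pr e (pr s (pr t r))) = move S v e s t r"
  by (simp add: step_def clock_def)

text \<open>Only clocks are compared, so the clocks of a descending sequence form a branch through
  \<open>S\<close>.\<close>

definition prec :: "(nat \<Rightarrow> bool) \<Rightarrow> nat \<Rightarrow> nat \<Rightarrow> bool" where
  "prec S y x \<longleftrightarrow> extends (clock x) (clock y) \<and> S (clock y)"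

lemma prec_trans: "prec S z y \<Longrightarrow> prec S y x \<Longrightarrow> prec S z x"
  unfolding prec_def using extends_trans by blast

lemma step_mono:
  assumes "step S v x" and "\<And>y. prec S y x \<Longrightarrow> v y \<noteq> 0 \<Longrightarrow> w y \<noteq> 0"
  shows "step S w x"
proof -
  let ?e = "pfst x" and ?s = "pfst (psnd x)" and ?t = "pfst (psnd (psnd x))"
  obtain s' where s': "extends ?s s'" "tree ?e ?e 2 s'"
    and v: "\<And>t' r'. extends ?t t' \<Longrightarrow> tree ?e ?e 1 t' \<Longrightarrow> extends (clock x) r' \<Longrightarrow> S r' \<Longrightarrow>
      v (pr ?e (pr s' (pr t' r'))) \<noteq> 0"
    using assms(1) unfolding step_def move_def by blast
  have "w (pr ?e (pr s' (pr t' r'))) \<noteq> 0"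
    if "extends ?t t'" "tree ?e ?e 1 t'" "extends (clock x) r'" "S r'" for t' r'
    using v[OF that] that by (intro assms(2)) (simp_all add: prec_def clock_def)
  with s' show ?thesis
    unfolding step_def move_def by blast
qed

text \<open>Every position consulted by \<open>move\<close> arises from a legal reply of the second
  player and is thus \<open>prec\<close>-below \<open>x\<close>. The fixpoint equation is therefore
  a recursion along \<open>prec\<close>.\<close>

lemma step_cong:
  assumes "\<And>y. prec S y x \<Longrightarrow> v y = w y"
  shows "step S v x \<longleftrightarrow> step S w x"
  using assms step_mono[of S v x w] step_mono[of S w x v] by auto

lemma fixpoint_exists: "\<exists>v. \<forall>x. v x = of_bool (step S v x)"
proof -
  define \<Phi> where "\<Phi> U = {x. step S (\<lambda>y. of_bool (y \<in> U)) x}" for U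
  have "mono \<Phi>"
  proof (rule monoI)
    fix U W :: "nat set"
    assume "U \<subseteq> W"
    then have "step S (\<lambda>y. of_bool (y \<in> W)) x" if "step S (\<lambda>y. of_bool (y \<in> U)) x" for x
      by (intro step_mono[OF that]) auto
    then show "\<Phi> U \<subseteq> \<Phi> W"
      unfolding \<Phi>_def by blast
  qed
  then have "\<Phi> (lfp \<Phi>) = lfp \<Phi>"
    by (rule lfp_fixpoint)
  then have "x \<in> lfp \<Phi> \<longleftrightarrow> step S (\<lambda>y. of_bool (y \<in> lfp \<Phi>)) x" for x
    unfolding \<Phi>_def by blast
  then have "\<forall>x. of_bool (x \<in> lfp \<Phi>) = of_bool (step S (\<lambda>y. of_bool (y \<in> lfp \<Phi>)) x)"
    by (intro allI arg_cong[of _ _ of_bool])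
  then show ?thesis
    by (rule exI[of _ "\<lambda>x. of_bool (x \<in> lfp \<Phi>)"])
qed

text \<open>
  If \<open>v\<close> were 0 at the root, the first player could follow a true table, and the answers that keep
  \<open>v\<close> at 0 would build a table for the second player.
\<close>

lemma fixpoint_win:
  assumes fp: "\<And>x. v x = of_bool (step S v x)"
    and g: "ev g e e = 2" and no: "\<not> (\<exists>h. ev h e e = 1)"
  shows "v (pr e (pr 0 (pr 0 0))) \<noteq> 0"
proof
  assume v0: "v (pr e (pr 0 (pr 0 0))) = 0"
  let ?g = "\<lambda>p. ev g (pfst p) (psnd p)"
  define P where "P = (\<lambda>(s, t, r). approx ?g s \<and> v (pr e (pr s (pr t r))) = 0)"
  have "P (0, 0, 0)"
    using v0 by (simp add: P_def approx_0)
  moreover have "\<exists>y. P y \<and> extends (fst (snd x)) (fst (snd y)) \<and> tree e e 1 (fst (snd y))" if "P x" for x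
  proof -
    obtain s t r where x: "x = (s, t, r)" by (cases x)
    have "approx ?g s"
      using that by (simp add: P_def x)
    then obtain s' where s': "approx ?g s'" "extends s s'"
      by (rule approx_extend)
    have "\<not> move S v e s t r"
      using that fp[of "pr e (pr s (pr t r))"] by (simp add: P_def x)
    then obtain t' r' where "extends t t'" "tree e e 1 t'" "v (pr e (pr s' (pr t' r'))) = 0"
      using s'(2) approx_tree[OF s'(1) g] unfolding move_def by blast
    then show ?thesis
      using s'(1) by (intro exI[of _ "(s', t', r')"]) (simp add: P_def x)
  qed
  ultimately show False
    using tree_chain[of P "(0, 0, 0)" "\<lambda>x. fst (snd x)" e e 1] no by blast
qed

text \<open>Dual to \<open>fixpoint_win\<close>: the second player follows a true table and the
  branch \<open>\<rho>\<close>, which keeps every reply legal. If \<open>v\<close> were nonzero at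
  the root, the moves of the first player that keep it nonzero would build a table with value
  2.\<close>

lemma fixpoint_lose:
  assumes fp: "\<And>x. v x = of_bool (step S v x)"
    and S: "\<rho> 0 = 0" "\<And>n. extends (\<rho> n) (\<rho> (Suc n))" "\<And>n. S (\<rho> n)"
    and h: "ev h e e = 1" and no: "\<not> (\<exists>g. ev g e e = 2)"
  shows "v (pr e (pr 0 (pr 0 0))) = 0"
proof (rule ccontr)
  assume v0: "v (pr e (pr 0 (pr 0 0))) \<noteq> 0"
  let ?h = "\<lambda>p. ev h (pfst p) (psnd p)"
  define P where "P = (\<lambda>(s, t, n). approx ?h t \<and> v (pr e (pr s (pr t (\<rho> n)))) \<noteq> 0)"
  have "P (0, 0, 0)"
    using v0 S(1) by (simp add: P_def approx_0)
  moreover have "\<exists>y. P y \<and> extends (fst x) (fst y) \<and> tree e e 2 (fst y)" if "P x" for x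
  proof -
    obtain s t n where x: "x = (s, t, n)" by (cases x)
    have "approx ?h t"
      using that by (simp add: P_def x)
    then obtain t' where t': "approx ?h t'" "extends t t'"
      by (rule approx_extend)
    have "move S v e s t (\<rho> n)"
      using that fp[of "pr e (pr s (pr t (\<rho> n)))"] by (simp add: P_def x)
    then obtain s' where "extends s s'" "tree e e 2 s'" "v (pr e (pr s' (pr t' (\<rho> (Suc n))))) \<noteq> 0"
      using t'(2) approx_tree[OF t'(1) h] S(2,3) unfolding move_def by blast
    then show ?thesis
      using t'(1) by (intro exI[of _ "(s', t', Suc n)"]) (simp add: P_def x)
  qed
  ultimately show False
    using tree_chain[of P "(0, 0, 0)" fst e e 2] no by blast
qed

lemma fixpoint_not_HD:
  assumes fp: "\<And>x. v x = of_bool (step S v x)"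
    and S: "\<rho> 0 = 0" "\<And>n. extends (\<rho> n) (\<rho> (Suc n))" "\<And>n. S (\<rho> n)"
  shows "\<not> HD v"
proof
  assume "HD v"
  \<comment> \<open>\<open>X v\<close> takes the value sought by the player whom \<open>v\<close>
    does not name as winner. If \<open>e\<close> codes \<open>X v\<close>, only that player has a
    witness at \<open>e\<close>, so \<open>v\<close> names the wrong winner.\<close>
  define X :: "(nat \<Rightarrow> nat) \<Rightarrow> nat \<Rightarrow> nat"
    where "X w e = (if w (pr e (pr 0 (pr 0 0))) = 0 then 1 else 0)" for w e
  have "AO X"
    unfolding X_def by (intro AO_intros)
  from HD_AO[OF \<open>HD v\<close> this] obtain e where e: "\<And>n i. X v n = i \<longleftrightarrow> (\<exists>h. ev h e n = Suc i)"
    using HD_code by blast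
  show False
  proof (cases "v (pr e (pr 0 (pr 0 0))) = 0")
    case True
    then have "X v e = 1" "X v e \<noteq> 0"
      by (simp_all add: X_def)
    then obtain g where "ev g e e = 2" "\<not> (\<exists>h. ev h e e = 1)"
      unfolding e by (auto simp: numeral_2_eq_2)
    from fixpoint_win[OF fp this] True show False by simp
  next
    case False
    then have "X v e = 0" "X v e \<noteq> 1"
      by (simp_all add: X_def)
    then obtain h where "ev h e e = 1" "\<not> (\<exists>g. ev g e e = 2)"
      unfolding e by (auto simp: numeral_2_eq_2)
    from fixpoint_lose[OF fp S this] False show False by simp
  qed
qed

section \<open>The game is arithmetical\<close>

lemma AOP_comp: "AOP P \<Longrightarrow> AO A \<Longrightarrow> AOP (\<lambda>f x. P f (A f x))"
  unfolding AOP_def by (rule AO_comp)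

lemma AO_val: "AO A \<Longrightarrow> AO B \<Longrightarrow> AO (\<lambda>f x. val (A f x) (B f x))"
  unfolding val_def by (intro AO_intros)

lemma AO_clock: "AO A \<Longrightarrow> AO (\<lambda>f x. clock (A f x))"
  unfolding clock_def by (intro AO_intros)

lemma AO_opc: "AO A \<Longrightarrow> AO (\<lambda>f x. opc (A f x))"
  and AO_lft: "AO A \<Longrightarrow> AO (\<lambda>f x. lft (A f x))"
  and AO_rgt: "AO A \<Longrightarrow> AO (\<lambda>f x. rgt (A f x))"
  unfolding opc_def lft_def rgt_def by (intro AO_intros; assumption)+

lemma AO_inner_pos: "AO A \<Longrightarrow> AO B \<Longrightarrow> AO (\<lambda>f x. inner_pos (A f x) (B f x))"
  unfolding inner_pos_def by (intro AO_intros AO_opc AO_rgt)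

lemma AO_outer_pos: "AO A \<Longrightarrow> AO B \<Longrightarrow> AO C \<Longrightarrow> AO (\<lambda>f x. outer_pos (A f x) (B f x) (C f x))"
  unfolding outer_pos_def by (intro AO_intros AO_opc AO_lft)

lemma AOP_satisfies_val:
  assumes "AO s" "AO t" "AO y"
  shows "AOP (\<lambda>f x. satisfies (val (s f x)) (t f x) (y f x))"
  unfolding satisfies_def clause_def by (intro AO_intros AO_opc AO_val AO_inner_pos AO_outer_pos assms)

lemma AOP_extends:
  assumes "AO A" "AO B"
  shows "AOP (\<lambda>f x. extends (A f x) (B f x))"
proof -
  have "AOP (\<lambda>f x. extends (pfst x) (psnd x))"
    unfolding extends_def by (intro AO_intros AO_val)
  from AOP_comp[OF this AO_pr[OF assms]] show ?thesis by simp
qed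

lemma AOP_tree:
  assumes "AO e" "AO a" "AO b" "AO s"
  shows "AOP (\<lambda>f x. tree (e f x) (a f x) (b f x) (s f x))"
proof -
  have "AOP (\<lambda>f x. tree (pfst x) (pfst (psnd x)) (pfst (psnd (psnd x))) (psnd (psnd (psnd x))))"
    unfolding tree_def by (intro AO_intros AO_val AO_inner_pos AO_outer_pos AOP_satisfies_val)
  from AOP_comp[OF this AO_pr[OF assms(1) AO_pr[OF assms(2) AO_pr[OF assms(3,4)]]]]
  show ?thesis by simp
qed

lemma AOP_step:
  assumes "AOP (\<lambda>f. S)" "AO A"
  shows "AOP (\<lambda>f x. step S f (A f x))"
proof -
  have "AOP (\<lambda>f x. move S f (pfst x) (pfst (psnd x)) (pfst (psnd (psnd x))) (clock x))"
    unfolding move_def by (intro AO_intros AO_clock AOP_extends AOP_tree AOP_comp[OF assms(1)])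
  from AOP_comp[OF this assms(2)] show ?thesis by (simp only: step_def)
qed

lemma AOP_prec:
  assumes "AOP (\<lambda>f. S)" "AO A" "AO B"
  shows "AOP (\<lambda>f x. prec S (A f x) (B f x))"
  unfolding prec_def by (intro AO_intros AO_clock AOP_extends AOP_comp[OF assms(1)] assms(2,3))

lemma tree_chain_exists:
  assumes "ev h e a = b"
  obtains \<rho> where "\<rho> 0 = 0" "\<And>n. extends (\<rho> n) (\<rho> (Suc n))" "\<And>n. tree e a b (\<rho> n)"
proof -
  let ?g = "\<lambda>p. ev h (pfst p) (psnd p)"
  have "\<exists>\<rho>. \<forall>n. (approx ?g (\<rho> n) \<and> (n = 0 \<longrightarrow> \<rho> n = 0)) \<and> extends (\<rho> n) (\<rho> (Suc n))"
  proof (rule dependent_nat_choice)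
    show "\<exists>x. approx ?g x \<and> ((0 :: nat) = 0 \<longrightarrow> x = 0)"
      using approx_0 by blast
    show "\<exists>y. (approx ?g y \<and> (Suc n = 0 \<longrightarrow> y = 0)) \<and> extends x y"
      if "approx ?g x \<and> (n = 0 \<longrightarrow> x = 0)" for x n
      using that approx_extend[of ?g x] by blast
  qed
  then obtain \<rho> where "\<And>n. approx ?g (\<rho> n)" "\<rho> 0 = 0" "\<And>n. extends (\<rho> n) (\<rho> (Suc n))"
    by blast
  then show thesis
    using that approx_tree[OF _ assms] by blast
qed

text \<open>
  The code \<open>r\<close> of the operator that tests for a solution of the game with trivial \<open>S\<close>.
\<close>

lemma clock_code_exists:
  obtains r where "\<exists>h. ev h r 0 = 1" "\<And>h. ev h r 0 = 1 \<Longrightarrow> \<not> HD h"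
proof -
  let ?fp = "\<lambda>v. \<forall>y. v y = of_bool (step (\<lambda>_. True) v y)"
  have "AOP (\<lambda>v x. ?fp v)"
    by (intro AOP_all AOP_eq AO_oracle AO_pfst AO_id AO_of_bool AOP_step)
      (simp add: AOP_def AO_const)
  then obtain r where "\<forall>v. ev v r = (\<lambda>x. of_bool (?fp v))"
    unfolding AOP_def AO_def ..
  then have r: "ev v r 0 = 1 \<longleftrightarrow> ?fp v" for v
    by (simp only: of_bool_eq_1_iff)
  \<comment> \<open>For trivial \<open>S\<close> any strictly extending chain from 0 serves as a
    branch; the table of the oracle \<open>id\<close> provides one.\<close>
  obtain \<rho> where \<rho>: "\<rho> 0 = 0" "\<And>n. extends (\<rho> n) (\<rho> (Suc n))"
    and "\<And>n. tree 0 0 0 (\<rho> n)"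
    by (rule tree_chain_exists[of id 0 0 0]) simp_all
  show thesis
  proof (rule that)
    show "\<exists>h. ev h r 0 = 1"
      unfolding r by (rule fixpoint_exists)
    show "\<not> HD h" if "ev h r 0 = 1" for h
      using that fixpoint_not_HD[of h "\<lambda>_. True", OF _ \<rho>] unfolding r by blast
  qed
qed

section \<open>Descending sequences and minimal errors\<close>

lemma mu_witness: "\<exists>y. h y \<noteq> 0 \<Longrightarrow> h (mu h - 1) \<noteq> 0"
  by (auto simp: mu_def intro: LeastI)

text \<open>Always choosing the numerically least element further down gives a descending sequence
  arithmetical in \<open>P\<close>. By \<open>tree_limit\<close> its clocks then yield an
  \<open>h\<close> with \<open>HD h\<close> and \<open>ev h r 0 = 1\<close>.\<close>

lemma prec_no_descent:
  assumes r: "\<And>h. ev h r 0 = 1 \<Longrightarrow> \<not> HD h" and "HD P" and ex: "\<exists>x. P x \<noteq> 0"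
  shows "\<exists>x. P x \<noteq> 0 \<and> (\<forall>y. prec (tree r 0 1) y x \<longrightarrow> P y = 0)"
proof (rule ccontr)
  assume desc: "\<not> ?thesis"
  let ?R = "tree r 0 1"
  define nxt :: "(nat \<Rightarrow> nat) \<Rightarrow> nat \<Rightarrow> nat"
    where "nxt f x = mu (\<lambda>y. of_bool (\<not> f y = 0 \<and> prec ?R y x)) - 1" for f x
  define Y :: "(nat \<Rightarrow> nat) \<Rightarrow> nat \<Rightarrow> nat"
    where "Y f n = (nxt f ^^ n) (mu f - 1)" for f n
  define \<Psi> :: "(nat \<Rightarrow> nat) \<Rightarrow> nat \<Rightarrow> nat"
    where "\<Psi> f x = val (clock (Y f (Suc (pr 0 x)))) (pr 0 x)" for f x
  have R: "AOP (\<lambda>f. ?R)"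
    by (intro AOP_tree AO_intros)
  have "AO Y"
    unfolding Y_def nxt_def by (intro AO_intros AOP_prec R)
  then have "AO \<Psi>"
    unfolding \<Psi>_def by (intro AO_val AO_clock AO_comp[OF \<open>AO Y\<close>] AO_intros)
  with \<open>HD P\<close> have "HD (\<Psi> P)"
    by (rule HD_AO)
  have nxt: "P (nxt P x) \<noteq> 0 \<and> prec ?R (nxt P x) x" if "P x \<noteq> 0" for x
    using mu_witness[of "\<lambda>y. of_bool (\<not> P y = 0 \<and> prec ?R y x)"] desc that
    unfolding nxt_def of_bool_eq_0_iff not_not by blast
  have P: "P (Y P n) \<noteq> 0" for n
    by (induction n) (use mu_witness[OF ex] nxt in \<open>simp_all add: Y_def\<close>)
  have "prec ?R (Y P (Suc n)) (Y P n)" for n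
    using nxt[OF P[of n]] by (simp add: Y_def)
  then have "ev (\<Psi> P) r 0 = 1"
    unfolding \<Psi>_def by (intro tree_limit) (simp_all add: prec_def)
  then show False
    using r \<open>HD (\<Psi> P)\<close> by blast
qed

text \<open>Being first refers to \<open>prec\<close>, not to the numerical order, so a function may
  have several first errors; \<open>F\<close> will select the numerically least.\<close>

definition first_error :: "(nat \<Rightarrow> bool) \<Rightarrow> (nat \<Rightarrow> nat) \<Rightarrow> nat \<Rightarrow> bool" where
  "first_error S f x \<longleftrightarrow> f x \<noteq> of_bool (step S f x) \<and>
     (\<forall>y. prec S y x \<longrightarrow> f y = of_bool (step S f y))"

lemma AOP_first_error:
  assumes "AOP (\<lambda>f. S)" "AO A"
  shows "AOP (\<lambda>f x. first_error S f (A f x))"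
proof -
  have "AOP (\<lambda>f x. f x \<noteq> of_bool (step S f x) \<and> (\<forall>y. prec S y x \<longrightarrow> f y = of_bool (step S f y)))"
    by (intro AO_intros AOP_step AOP_prec assms(1))
  from AOP_comp[OF this assms(2)] show ?thesis by (simp only: first_error_def)
qed

text \<open>Without errors \<open>f\<close> would solve the recursion, which
  \<open>fixpoint_not_HD\<close> excludes by means of the branch obtained from \<open>g\<close>. The
  set of errors is arithmetical in \<open>f\<close>, so it has a \<open>prec\<close>-minimal
  element.\<close>

lemma first_error_exists:
  assumes r: "\<And>h. ev h r 0 = 1 \<Longrightarrow> \<not> HD h" and g: "ev g r 0 = 1" and "HD f"
  shows "\<exists>x. first_error (tree r 0 1) f x"
proof -
  let ?R = "tree r 0 1"
  define E :: "(nat \<Rightarrow> nat) \<Rightarrow> nat \<Rightarrow> nat"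
    where "E f x = of_bool (\<not> f x = of_bool (step ?R f x))" for f x
  have "AOP (\<lambda>f. ?R)"
    by (intro AOP_tree AO_intros)
  then have "AO E"
    unfolding E_def by (intro AO_intros AOP_step)
  with \<open>HD f\<close> have "HD (E f)"
    by (rule HD_AO)
  moreover have "\<exists>x. E f x \<noteq> 0"
  proof (rule ccontr)
    assume "\<not> ?thesis"
    then have "f x = of_bool (step ?R f x)" for x
      unfolding E_def of_bool_eq_0_iff not_not by blast
    moreover obtain \<rho> where "\<rho> 0 = 0" "\<And>n. extends (\<rho> n) (\<rho> (Suc n))" "\<And>n. ?R (\<rho> n)"
      using tree_chain_exists[OF g] by metis
    ultimately have "\<not> HD f"
      by (rule fixpoint_not_HD)
    with \<open>HD f\<close> show False by blast
  qed
  ultimately obtain x where "E f x \<noteq> 0" "\<forall>y. prec ?R y x \<longrightarrow> E f y = 0"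
    using prec_no_descent[OF r] by blast
  then show ?thesis
    unfolding first_error_def E_def of_bool_eq_0_iff not_not by blast
qed

text \<open>Otherwise \<open>f\<close> and \<open>g\<close> differ somewhere below \<open>x\<close>.
  At a minimal such place both are correct and agree on everything below it, so they agree there
  too.\<close>

lemma first_error_agree:
  assumes r: "\<And>h. ev h r 0 = 1 \<Longrightarrow> \<not> HD h" and "HD f" "HD g"
    and f: "first_error (tree r 0 1) f x" and g: "first_error (tree r 0 1) g x"
  shows "step (tree r 0 1) f x \<longleftrightarrow> step (tree r 0 1) g x"
proof (rule ccontr)
  let ?R = "tree r 0 1"
  assume neq: "\<not> ?thesis"
  define D :: "(nat \<Rightarrow> nat) \<Rightarrow> nat \<Rightarrow> nat"
    where "D h y = of_bool (prec ?R y x \<and> \<not> pfst (h y) = psnd (h y))" for h y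
  let ?h = "\<lambda>y. pr (f y) (g y)"
  have R: "AOP (\<lambda>f. ?R)"
    by (intro AOP_tree AO_intros)
  have "AO D"
    unfolding D_def by (intro AO_intros AOP_prec R)
  with HD_pr[OF \<open>HD f\<close> \<open>HD g\<close>] have "HD (D ?h)"
    by (rule HD_AO)
  moreover have "\<exists>y. D ?h y \<noteq> 0"
    using neq step_cong[of ?R x f g] by (auto simp: D_def)
  ultimately obtain y where "D ?h y \<noteq> 0" and min: "\<And>z. prec ?R z y \<Longrightarrow> D ?h z = 0"
    using prec_no_descent[OF r] by blast
  then have y: "prec ?R y x" "f y \<noteq> g y"
    by (auto simp: D_def split: if_splits)
  have "f z = g z" if "prec ?R z y" for z
    using min[OF that] prec_trans[OF that y(1)] by (simp add: D_def)
  then have "step ?R f y \<longleftrightarrow> step ?R g y"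
    by (rule step_cong)
  then show False
    using f g y by (simp add: first_error_def)
qed

theorem theorem5p1:
  shows "\<exists>F :: (nat \<Rightarrow> nat) \<Rightarrow> nat.
           computable_on_cantor_in E2 F \<and>
           \<not> cantor \<subseteq> (\<Union>f \<in> {f \<in> cantor. hyperarithmetical f}. nbhd (map f [0..<F f]))"
proof -
  obtain r g where g: "ev g r 0 = 1" and r: "\<And>h. ev h r 0 = 1 \<Longrightarrow> \<not> HD h"
    using clock_code_exists by metis
  let ?R = "tree r 0 1"
  \<comment> \<open>The default 0 makes \<open>F\<close> total. The shift by one ensures that the
    neighbourhood of \<open>f\<close> fixes the value at the erroneous place itself.\<close>
  define F where "F f = mu (\<lambda>x. of_bool (first_error ?R f x))" for f
  have "AOP (\<lambda>f. ?R)"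
    by (intro AOP_tree AO_intros)
  then have "AO (\<lambda>f x. F f)"
    unfolding F_def by (intro AO_mu AO_of_bool AOP_first_error AO_pfst AO_id)
  then have computable: "computable_on_cantor_in E2 F"
    using AO_kleene[of "\<lambda>f x. F f"] unfolding computable_on_cantor_in_def by blast
  have F: "\<exists>x. F f = Suc x \<and> first_error ?R f x" if "hyperarithmetical f" for f
    using first_error_exists[OF r g hyperarithmetical_HD[OF that]]
    unfolding F_def mu_def by (auto intro: LeastI)
  \<comment> \<open>Both values are binary and differ from the same truth value.\<close>
  have agree: "f x = f' x"
    if "f \<in> cantor" "hyperarithmetical f" "first_error ?R f x"
      and "f' \<in> cantor" "hyperarithmetical f'" "first_error ?R f' x" for f f' x
  proof -
    have "step ?R f x \<longleftrightarrow> step ?R f' x"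
      using first_error_agree[OF r] hyperarithmetical_HD that by blast
    moreover have "f x \<in> {0, 1}" "f' x \<in> {0, 1}"
      using that by (auto simp: cantor_def)
    moreover have "f x \<noteq> of_bool (step ?R f x)" "f' x \<noteq> of_bool (step ?R f' x)"
      using that(3,6) unfolding first_error_def by blast+
    ultimately show ?thesis
      by (cases "step ?R f x") auto
  qed
  \<comment> \<open>\<open>X\<close> flips the wrong value at each first error, which by
    \<open>agree\<close> does not depend on the chosen \<open>f\<close>; elsewhere it is 0.\<close>
  define X :: "nat \<Rightarrow> nat" where "X x = of_bool (\<exists>f\<in>cantor. hyperarithmetical f \<and>
    first_error ?R f x \<and> f x = 0)" for x
  have "X \<in> cantor"
    by (auto simp: cantor_def X_def)
  moreover have "X \<notin> nbhd (map f [0..<F f])" if f: "f \<in> cantor" "hyperarithmetical f" for f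
  proof
    obtain x where x: "F f = Suc x" "first_error ?R f x"
      using F[OF f(2)] by blast
    assume "X \<in> nbhd (map f [0..<F f])"
    then have "X x = f x"
      by (simp add: nbhd_def x)
    moreover have "X x = 1 \<longleftrightarrow> f x = 0"
      unfolding X_def of_bool_eq_1_iff using agree[OF f x(2)] f x(2) by metis
    moreover have "X x \<in> {0, 1}"
      by (auto simp: X_def)
    ultimately show False by auto
  qed
  ultimately show ?thesis
    using computable by blast
qed

end
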